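(* In any coordination game, for the perturbed learning automata dynamics, as $\epsilon\downarrow0$ and $\lambda\downarrow0$ the set $\mathcal{S}^*$ of stochastically stable pure strategy states satisfies $\mathcal{S}^*\subseteq\mathcal{S}_{\rm NE}$, where $\mathcal{S}_{\rm NE}$ is the set of pure strategy states corresponding to pure Nash equilibria.
   Context: Finite game: players $\mathcal{I}=\{1,\dots,n\}$, finite action sets $\mathcal{A}_i$, $\mathcal{A}=\prod_i\mathcal{A}_i$, utilities $u_i:\mathcal{A}\to\mathbb{R}$. ${\rm BR}_i(\alpha)=\arg\max_{a\in\mathcal{A}_i}u_i(a,\alpha_{-i})$; a pure Nash equilibrium is $\alpha^*$ with $\alpha^*_i\in{\rm BR}_i(\alpha^* )$ for all $i$. Coordination game: $u_i(\alpha)>0$ for all $i,\alpha$, and for every $\alpha$, player $i$ and $\alpha'_i\in{\rm BR}_i(\alpha)$, $u_j(\alpha'_i,\alpha_{-i})\ge u_j(\alpha_i,\alpha_{-i})$ for all $j$. Perturbed learning automata (step size $\epsilon>0$ with $0<\epsilon u_i(\alpha)<1$, perturbation $\lambda>0$): state $(\alpha,x)$ with $x_i\in\Delta(|\mathcal{A}_i|)$ (actions identified with unit vectors $e_{\alpha_i}$); each agent $i$ independently picks $\alpha_i(t+1)$ according to $x_i(t)$ w.p. $1-\lambda$ and uniformly on $\mathcal{A}_i$ w.p. $\lambda$, then $x_i(t+1)=x_i(t)+\epsilon u_i(\alpha(t+1))(e_{\alpha_i(t+1)}-x_i(t))$. Pure strategy states: $(\alpha,x)$ with $x_i=e_{\alpha_i}$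 for all $i$ (set $\mathcal{S}$). Any invariant probability measures $\mu_\lambda$ of this chain converge weakly as $\lambda\to0$ to $\sum_{s\in\mathcal{S}}\pi_s\delta_s$ for a probability vector $\pi=\pi(\epsilon)$; a pure strategy state $s$ is stochastically stable (as $\epsilon\downarrow0,\lambda\downarrow0$) if $\pi_s(\epsilon)$ does not vanish as $\epsilon\downarrow0$. *)

theory Defs
  imports "HOL-Analysis.Analysis" "HOL-Probability.Probability"
begin

text \<open>Finite game: players are the elements of the finite type 'i, player i has the
finite nonempty action set A i (a subset of the finite type 'a), utilities u i \<alpha>.\<close>

definition profiles :: "('i \<Rightarrow> 'a set) \<Rightarrow> ('i \<Rightarrow> 'a) set" where
  "profiles A = {\<alpha>. \<forall>i. \<alpha> i \<in> A i}"

definition BR :: "('i \<Rightarrow> 'a set) \<Rightarrow> ('i \<Rightarrow> ('i \<Rightarrow> 'a) \<Rightarrow> real) \<Rightarrow> 'i \<Rightarrow> ('i \<Rightarrow> 'a) \<Rightarrow> 'a set" where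
  "BR A u i \<alpha> = {a \<in> A i. \<forall>b \<in> A i. u i (\<alpha>(i := b)) \<le> u i (\<alpha>(i := a))}"

definition pure_NE :: "('i \<Rightarrow> 'a set) \<Rightarrow> ('i \<Rightarrow> ('i \<Rightarrow> 'a) \<Rightarrow> real) \<Rightarrow> ('i \<Rightarrow> 'a) \<Rightarrow> bool" where
  "pure_NE A u \<alpha> \<longleftrightarrow> \<alpha> \<in> profiles A \<and> (\<forall>i. \<alpha> i \<in> BR A u i \<alpha>)"

definition coordination_game :: "('i \<Rightarrow> 'a set) \<Rightarrow> ('i \<Rightarrow> ('i \<Rightarrow> 'a) \<Rightarrow> real) \<Rightarrow> bool" where
  "coordination_game A u \<longleftrightarrow>
     (\<forall>i. \<forall>\<alpha> \<in> profiles A. u i \<alpha> > 0) \<and>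
     (\<forall>\<alpha> \<in> profiles A. \<forall>i. \<forall>a' \<in> BR A u i \<alpha>. \<forall>j. u j (\<alpha>(i := a')) \<ge> u j \<alpha>)"

definition unitv :: "'a \<Rightarrow> 'a \<Rightarrow> real" where
  "unitv a = (\<lambda>b. if b = a then 1 else 0)"

definition states :: "('i \<Rightarrow> 'a set) \<Rightarrow> (('i \<Rightarrow> 'a) \<times> ('i \<Rightarrow> 'a \<Rightarrow> real)) set" where
  "states A = {(\<alpha>, x). \<alpha> \<in> profiles A \<and>
      (\<forall>i. (\<forall>b. x i b \<ge> 0) \<and> (\<forall>b. b \<notin> A i \<longrightarrow> x i b = 0) \<and> sum (x i) (A i) = 1)}"

definition state_measure :: "('i \<Rightarrow> 'a set) \<Rightarrow> (('i \<Rightarrow> 'a) \<times> ('i \<Rightarrow> 'a \<Rightarrow> real)) measure" where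
  "state_measure A = restrict_space (count_space UNIV \<Otimes>\<^sub>M borel) (states A)"

definition pure_state :: "('i \<Rightarrow> 'a) \<Rightarrow> ('i \<Rightarrow> 'a) \<times> ('i \<Rightarrow> 'a \<Rightarrow> real)" where
  "pure_state \<alpha> = (\<alpha>, \<lambda>i. unitv (\<alpha> i))"

definition sel_prob :: "('i::finite \<Rightarrow> 'a set) \<Rightarrow> real \<Rightarrow>
    ('i \<Rightarrow> 'a) \<times> ('i \<Rightarrow> 'a \<Rightarrow> real) \<Rightarrow> ('i \<Rightarrow> 'a) \<Rightarrow> real" where
  "sel_prob A lam s \<alpha>' = (\<Prod>i\<in>UNIV. (1 - lam) * snd s i (\<alpha>' i) + lam / real (card (A i)))"

definition next_state :: "('i \<Rightarrow> ('i \<Rightarrow> 'a) \<Rightarrow> real) \<Rightarrow> real \<Rightarrow>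
    ('i \<Rightarrow> 'a) \<times> ('i \<Rightarrow> 'a \<Rightarrow> real) \<Rightarrow> ('i \<Rightarrow> 'a) \<Rightarrow> ('i \<Rightarrow> 'a) \<times> ('i \<Rightarrow> 'a \<Rightarrow> real)" where
  "next_state u \<epsilon> s \<alpha>' =
     (\<alpha>', \<lambda>i b. snd s i b + \<epsilon> * u i \<alpha>' * (unitv (\<alpha>' i) b - snd s i b))"

definition invariant_pm :: "('i::finite \<Rightarrow> 'a set) \<Rightarrow> ('i \<Rightarrow> ('i \<Rightarrow> 'a) \<Rightarrow> real) \<Rightarrow> real \<Rightarrow> real \<Rightarrow>
    (('i \<Rightarrow> 'a) \<times> ('i \<Rightarrow> 'a \<Rightarrow> real)) measure \<Rightarrow> bool" where
  "invariant_pm A u \<epsilon> lam \<mu> \<longleftrightarrow>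
     prob_space \<mu> \<and> sets \<mu> = sets (state_measure A) \<and>
     (\<forall>B \<in> sets (state_measure A).
        measure \<mu> B = (\<integral>s. (\<Sum>\<alpha>' \<in> profiles A. sel_prob A lam s \<alpha>' * indicator B (next_state u \<epsilon> s \<alpha>')) \<partial>\<mu>))"

text \<open>Test functions for weak convergence: bounded, measurable, continuous on the state space
(whose action-profile component is discrete).\<close>
definition test_fun :: "('i \<Rightarrow> 'a set) \<Rightarrow> (('i \<Rightarrow> 'a) \<times> ('i \<Rightarrow> 'a \<Rightarrow> real) \<Rightarrow> real) \<Rightarrow> bool" where
  "test_fun A f \<longleftrightarrow> f \<in> borel_measurable (state_measure A) \<and>
     (\<exists>C. \<forall>s \<in> states A. \<bar>f s\<bar> \<le> C) \<and>
     (\<forall>\<alpha> \<in> profiles A. continuous_on {x. (\<alpha>, x) \<in> states A} (\<lambda>x. f (\<alpha>, x)))"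

definition weak_conv_pure :: "('i \<Rightarrow> 'a set) \<Rightarrow> (real \<Rightarrow> (('i \<Rightarrow> 'a) \<times> ('i \<Rightarrow> 'a \<Rightarrow> real)) measure) \<Rightarrow>
    (('i \<Rightarrow> 'a) \<Rightarrow> real) \<Rightarrow> bool" where
  "weak_conv_pure A \<mu> w \<longleftrightarrow>
     (\<forall>f. test_fun A f \<longrightarrow>
        ((\<lambda>lam. \<integral>s. f s \<partial>(\<mu> lam)) \<longlongrightarrow> (\<Sum>\<alpha> \<in> profiles A. w \<alpha> * f (pure_state \<alpha>))) (at_right 0))"

definition admissible_step :: "('i \<Rightarrow> 'a set) \<Rightarrow> ('i \<Rightarrow> ('i \<Rightarrow> 'a) \<Rightarrow> real) \<Rightarrow> real \<Rightarrow> bool" where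
  "admissible_step A u \<epsilon> \<longleftrightarrow> \<epsilon> > 0 \<and> (\<forall>i. \<forall>\<alpha> \<in> profiles A. 0 < \<epsilon> * u i \<alpha> \<and> \<epsilon> * u i \<alpha> < 1)"

definition limit_weights :: "('i::finite \<Rightarrow> 'a set) \<Rightarrow> ('i \<Rightarrow> ('i \<Rightarrow> 'a) \<Rightarrow> real) \<Rightarrow> real \<Rightarrow>
    (('i \<Rightarrow> 'a) \<Rightarrow> real) \<Rightarrow> bool" where
  "limit_weights A u \<epsilon> w \<longleftrightarrow>
     (\<forall>\<alpha> \<in> profiles A. w \<alpha> \<ge> 0) \<and> (\<Sum>\<alpha> \<in> profiles A. w \<alpha>) = 1 \<and>
     (\<forall>\<mu>. (\<forall>lam \<in> {0<..<1}. invariant_pm A u \<epsilon> lam (\<mu> lam)) \<longrightarrow> weak_conv_pure A \<mu> w)"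

definition stochastically_stable :: "(real \<Rightarrow> ('i \<Rightarrow> 'a) \<Rightarrow> real) \<Rightarrow> ('i \<Rightarrow> 'a) \<Rightarrow> bool" where
  "stochastically_stable \<pi> \<alpha> \<longleftrightarrow> \<not> ((\<lambda>\<epsilon>. \<pi> \<epsilon> \<alpha>) \<longlongrightarrow> 0) (at_right 0)"

end

theory Submission
  imports Defs
begin

text \<open>
  If \<open>F\<close> is a continuous submartingale of the unperturbed dynamics, then invariance of the perturbed
  law, expanded to first order in the perturbation, says that under the limit weights a single tremble
  of one uniformly acting player does not increase \<open>F\<close> on average.

  A tremble of player \<open>i\<close> away from a pure state leaves the other players pure, so only the edge
  between two neighbouring pure states matters. On an edge along which the utility of \<open>i\<close> rises
  strictly, \<open>1 - exp (- \<rho> y / \<epsilon>)\<close> is a submartingale in the probability \<open>y\<close> of the better action,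
  and its value after one tremble is bounded away from 0 uniformly in \<open>\<epsilon>\<close>; if the utility of \<open>i\<close> merely
  does not fall, \<open>y\<close> itself is a submartingale, which loses only order \<open>\<epsilon>\<close> at the better end.
  Multiplying by a high power of the probability of staying on the edge makes both
  functions submartingales on the whole state space. The first kind bounds the weight of a profile
  by a constant times the weight of any strictly better reply; the maximum of both kinds over the
  edges at a Nash equilibrium bounds the weight of its improving neighbours by order \<open>\<epsilon>\<close>.
  In a coordination game best replies increase the total utility, so every other profile leads
  to a Nash equilibrium along best replies.

  Invariant laws have to be shown to exist, as otherwise the assumption on the limit weights would be
  void. Histories of action profiles are coded continuously by real numbers, which reduces this to
  Helly's selection theorem on the real line.
\<close>

section \<open>Invariant distributions of chains coded by the real line\<close>

text \<open>The line has room for \<open>N\<close> disjoint intervals, and on the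
  \<open>d\<close>-th one \<open>Z\<close> can be made to repeat, rescaled, the image of all of
  \<open>Z\<close> under \<open>g d\<close>. This self-similarity is a fixed point equation for a
  contraction of bounded continuous functions. A chain driven by the maps \<open>g d\<close> can
  then be run on the line.\<close>

lemma contractive_ifs_real_coding:
  fixes g :: "nat \<Rightarrow> 'v::banach \<Rightarrow> 'v"
  assumes S: "closed S" "convex S" "bounded S" "S \<noteq> {}"
    and q: "0 \<le> q" "q < 1"
    and gS: "\<And>d x. d < N \<Longrightarrow> x \<in> S \<Longrightarrow> g d x \<in> S"
    and lip: "\<And>d x y. d < N \<Longrightarrow> x \<in> S \<Longrightarrow> y \<in> S \<Longrightarrow> dist (g d x) (g d y) \<le> q * dist x y"
    and N: "0 < N"
  obtains T :: "nat \<Rightarrow> real \<Rightarrow> real" and Z :: "real \<Rightarrow> 'v"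
  where "\<And>d. continuous_on UNIV (T d)" "\<And>d c. d < N \<Longrightarrow> 0 \<le> T d c \<and> T d c \<le> 2 * real N"
    "continuous_on UNIV Z" "\<And>c. Z c \<in> S" "\<And>d c. d < N \<Longrightarrow> Z (T d c) = g d (Z c)"
proof -
  obtain p where p: "p \<in> S" using S by auto
  \<comment> \<open>A trapezoidal bump: 1 between \<open>2 * d\<close> and \<open>2 * d + 1\<close>,
    and 0 at distance 1/2 or more from there, so different bumps never overlap.\<close>
  define \<beta> where "\<beta> d y = max 0 (min 1 (2 - 2 * \<bar>y - 2 * real d - 1/2\<bar>))" for d y
  \<comment> \<open>Stretches the \<open>d\<close>-th unit interval onto the interval from 0 to
    \<open>2 * N\<close>, which contains all of them.\<close>
  define \<tau> where "\<tau> d y = 2 * real N * (y - 2 * real d)" for d y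
  define \<Phi>0 where "\<Phi>0 Y y = p + (\<Sum>d<N. \<beta> d y *\<^sub>R (g d (Y (\<tau> d y)) - p))" for Y :: "real \<Rightarrow> 'v" and y
  have \<beta>01: "0 \<le> \<beta> d y" "\<beta> d y \<le> 1" for d y by (auto simp: \<beta>_def)
  have \<beta>_disj: "\<beta> k y = 0" if "\<beta> d y \<noteq> 0" "k \<noteq> d" for k d y
  proof -
    have "\<bar>y - 2 * real d - 1/2\<bar> < 1" using that(1) by (auto simp: \<beta>_def max_def min_def split: if_splits)
    moreover have "\<bar>real k - real d\<bar> \<ge> 1" using that(2) by linarith
    ultimately have "\<bar>y - 2 * real k - 1/2\<bar> \<ge> 1" by linarith
    then show ?thesis by (auto simp: \<beta>_def)
  qed
  \<comment> \<open>At most one bump is nonzero at \<open>y\<close>, so the value is a convex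
    combination of \<open>p\<close> and a single image. This keeps it in \<open>S\<close> and passes
    the contraction factor of one map on to the whole operator.\<close>
  have \<Phi>0_cases: "(\<forall>Y. \<Phi>0 Y y = p) \<or>
     (\<exists>d<N. \<forall>Y. \<Phi>0 Y y = (1 - \<beta> d y) *\<^sub>R p + \<beta> d y *\<^sub>R g d (Y (\<tau> d y)))" for y
  proof (cases "\<exists>d<N. \<beta> d y \<noteq> 0")
    case True
    then obtain d where d: "d < N" "\<beta> d y \<noteq> 0" by auto
    have "\<Phi>0 Y y = (1 - \<beta> d y) *\<^sub>R p + \<beta> d y *\<^sub>R g d (Y (\<tau> d y))" for Y
    proof -
      have "(\<Sum>k<N. \<beta> k y *\<^sub>R (g k (Y (\<tau> k y)) - p)) = (\<Sum>k\<in>{d}. \<beta> k y *\<^sub>R (g k (Y (\<tau> k y)) - p))"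
        using d \<beta>_disj by (intro sum.mono_neutral_right) auto
      then show ?thesis by (simp add: \<Phi>0_def algebra_simps)
    qed
    then show ?thesis using d by blast
  next
    case False
    then show ?thesis by (auto simp: \<Phi>0_def)
  qed
  have \<Phi>0_S: "\<Phi>0 Y y \<in> S" if "\<And>c. Y c \<in> S" for Y y
    using \<Phi>0_cases[of y] p \<beta>01 gS that convexD_alt[OF S(2)] by metis
  have \<Phi>0_cont: "continuous_on UNIV (\<Phi>0 Y)" if Y: "\<And>c. Y c \<in> S" "continuous_on UNIV Y" for Y
  proof -
    have "continuous_on UNIV (\<lambda>y. g d (Y (\<tau> d y)))" if "d < N" for d
    proof (rule continuous_on_compose2[of S "g d"])
      show "continuous_on S (g d)"
        using lip[OF that] q by (intro lipschitz_on_continuous_on[of q] lipschitz_onI) auto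
      show "continuous_on UNIV (\<lambda>y. Y (\<tau> d y))"
        unfolding \<tau>_def by (intro continuous_on_compose2[OF Y(2)] continuous_intros) auto
    qed (use Y in auto)
    then show ?thesis unfolding \<Phi>0_def \<beta>_def by (intro continuous_intros) auto
  qed
  define \<Phi> where "\<Phi> Y = Bcontfun (\<Phi>0 (apply_bcontfun Y))" for Y
  \<comment> \<open>The maps \<open>g d\<close> are known to contract only on \<open>S\<close>, so
    the fixed point is sought among the functions with values in \<open>S\<close>, a closed
    set.\<close>
  let ?s = "PiC UNIV (\<lambda>_. S) :: (real \<Rightarrow>\<^sub>C 'v) set"
  have \<Phi>_apply: "apply_bcontfun (\<Phi> Y) = \<Phi>0 (apply_bcontfun Y)" if "Y \<in> ?s" for Y
  proof -
    have Y: "apply_bcontfun Y c \<in> S" for c using that by (auto simp: mem_PiC_iff)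
    have "bounded (range (\<Phi>0 (apply_bcontfun Y)))"
      by (rule bounded_subset[OF S(3)]) (use \<Phi>0_S[OF Y] in auto)
    then show ?thesis unfolding \<Phi>_def
      by (intro Bcontfun_inverse) (auto simp: bcontfun_def intro!: \<Phi>0_cont Y)
  qed
  have "\<exists>!Y. Y \<in> ?s \<and> \<Phi> Y = Y"
  proof (rule Banach_fix[where c=q])
    show "Topological_Spaces.complete ?s" using S(1) closed_PiC[of UNIV "\<lambda>_. S"] by (simp add: complete_eq_closed)
    have "const_bcontfun p \<in> ?s" using p by (auto simp: mem_PiC_iff)
    then show "?s \<noteq> {}" by auto
    show "\<Phi> ` ?s \<subseteq> ?s"
      using \<Phi>0_S by (auto simp: mem_PiC_iff \<Phi>_apply Pi_def)
    fix Y Y' assume Y: "Y \<in> ?s" "Y' \<in> ?s"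
    then have YS: "apply_bcontfun Y c \<in> S" "apply_bcontfun Y' c \<in> S" for c by (auto simp: mem_PiC_iff)
    show "dist (\<Phi> Y) (\<Phi> Y') \<le> q * dist Y Y'"
    proof (rule dist_bound)
      fix y
      have *: "dist (g d (apply_bcontfun Y c)) (g d (apply_bcontfun Y' c)) \<le> q * dist Y Y'" if "d < N" for d c
        using lip[OF that YS[of c]] mult_left_mono[OF dist_bounded[of Y c Y'] q(1)] by linarith
      have "dist (\<Phi>0 (apply_bcontfun Y) y) (\<Phi>0 (apply_bcontfun Y') y) \<le> q * dist Y Y'"
        using \<Phi>0_cases[of y]
      proof
        assume "\<forall>Y. \<Phi>0 Y y = p" then show ?thesis using q by simp
      next
        assume "\<exists>d<N. \<forall>Y. \<Phi>0 Y y = (1 - \<beta> d y) *\<^sub>R p + \<beta> d y *\<^sub>R g d (Y (\<tau> d y))"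
        then obtain d where d: "d < N" "\<And>Y. \<Phi>0 Y y = (1 - \<beta> d y) *\<^sub>R p + \<beta> d y *\<^sub>R g d (Y (\<tau> d y))" by auto
        have "dist (\<Phi>0 (apply_bcontfun Y) y) (\<Phi>0 (apply_bcontfun Y') y)
          = \<beta> d y * dist (g d (apply_bcontfun Y (\<tau> d y))) (g d (apply_bcontfun Y' (\<tau> d y)))"
          using \<beta>01[of d y] by (simp add: d(2) dist_norm scaleR_diff_right[symmetric])
        also have "\<dots> \<le> 1 * (q * dist Y Y')"
          using \<beta>01[of d y] *[OF d(1)] q by (intro mult_mono) auto
        finally show ?thesis by simp
      qed
      then show "dist (apply_bcontfun (\<Phi> Y) y) (apply_bcontfun (\<Phi> Y') y) \<le> q * dist Y Y'"
        by (simp add: \<Phi>_apply Y)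
    qed
  qed (use q in auto)
  then obtain Y where Y: "Y \<in> ?s" "\<Phi> Y = Y" by auto
  have YS: "apply_bcontfun Y c \<in> S" for c using Y by (auto simp: mem_PiC_iff)
  have Y_step: "apply_bcontfun Y (2 * real d + c / (2 * real N)) = g d (apply_bcontfun Y c)"
    if "d < N" "0 \<le> c" "c \<le> 2 * real N" for d c
  proof -
    let ?y = "2 * real d + c / (2 * real N)"
    have c: "0 \<le> c / (2 * real N)" "c / (2 * real N) \<le> 1" using that N by auto
    have "\<beta> d ?y = 1" using c unfolding \<beta>_def by (simp add: abs_if min_def max_def; linarith)
    then have "\<Phi>0 (apply_bcontfun Y) ?y = g d (apply_bcontfun Y (\<tau> d ?y))"
    proof -
      have "(\<Sum>k<N. \<beta> k ?y *\<^sub>R (g k (Y (\<tau> k ?y)) - p)) = (\<Sum>k\<in>{d}. \<beta> k ?y *\<^sub>R (g k (Y (\<tau> k ?y)) - p))"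
        using that \<beta>_disj[of d ?y] \<open>\<beta> d ?y = 1\<close> by (intro sum.mono_neutral_right) auto
      then show ?thesis using \<open>\<beta> d ?y = 1\<close> by (simp add: \<Phi>0_def)
    qed
    moreover have "\<tau> d ?y = c" using N by (simp add: \<tau>_def)
    ultimately show ?thesis using \<Phi>_apply[OF Y(1)] Y(2) by simp
  qed
  \<comment> \<open>The functional equation is established only for arguments between 0 and
    \<open>2 * N\<close>; projecting onto that interval extends it to the line.\<close>
  define clamp where "clamp c = max 0 (min (2 * real N) c)" for c
  define T where "T d c = 2 * real d + clamp c / (2 * real N)" for d c
  have cl: "0 \<le> clamp c" "clamp c \<le> 2 * real N" for c by (auto simp: clamp_def)
  have T: "0 \<le> T d c" "T d c \<le> 2 * real N" if "d < N" for d c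
  proof -
    have "clamp c / (2 * real N) \<le> 1" "0 \<le> clamp c / (2 * real N)" using cl[of c] N by auto
    moreover have "real d + 1 \<le> real N" using that by linarith
    ultimately show "0 \<le> T d c" "T d c \<le> 2 * real N" unfolding T_def by linarith+
  qed
  have clamp_cont: "continuous_on UNIV clamp" unfolding clamp_def by (intro continuous_intros)
  show ?thesis
  proof (rule that[of T "\<lambda>c. apply_bcontfun Y (clamp c)"])
    show "continuous_on UNIV (T d)" for d
      unfolding T_def using N clamp_cont by (intro continuous_intros) auto
    show "continuous_on UNIV (\<lambda>c. apply_bcontfun Y (clamp c))"
      by (rule continuous_on_compose2[OF _ clamp_cont, of UNIV]) auto
    fix d c assume "d < N"
    show "apply_bcontfun Y (clamp (T d c)) = g d (apply_bcontfun Y (clamp c))"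
      using T[OF \<open>d < N\<close>, of c] Y_step[OF \<open>d < N\<close> cl[of c]] by (simp add: clamp_def T_def)
  qed (use T YS in auto)
qed

section \<open>Laws after one step, and invariant laws of Feller chains\<close>

text \<open>The pair of old state and drawn branch has density \<open>q\<close> with respect to
  \<open>\<mu>\<close> times counting measure, and \<open>\<nu>\<close> is its image under the
  transition. Having an actual measure lets an identity known for sets or continuous functions be
  upgraded to bounded measurable functions.\<close>

lemma one_step_law:
  fixes \<mu> :: "'s measure" and N :: "'t measure" and q :: "'p \<Rightarrow> 's \<Rightarrow> real"
  assumes "prob_space \<mu>" and P: "finite P"
    and q: "\<And>p. p \<in> P \<Longrightarrow> q p \<in> borel_measurable \<mu>"
    and T: "\<And>p. p \<in> P \<Longrightarrow> T p \<in> \<mu> \<rightarrow>\<^sub>M N"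
    and q_nonneg: "\<And>p s. p \<in> P \<Longrightarrow> s \<in> space \<mu> \<Longrightarrow> 0 \<le> q p s"
    and q_sum: "\<And>s. s \<in> space \<mu> \<Longrightarrow> (\<Sum>p\<in>P. q p s) = 1"
  obtains \<nu> where "prob_space \<nu>" "sets \<nu> = sets N"
    "\<And>f :: 't \<Rightarrow> real. f \<in> borel_measurable N \<Longrightarrow> (\<And>x. x \<in> space N \<Longrightarrow> 0 \<le> f x \<and> f x \<le> 1) \<Longrightarrow>
      (\<integral>x. f x \<partial>\<nu>) = (\<integral>s. (\<Sum>p\<in>P. q p s * f (T p s)) \<partial>\<mu>)"
proof -
  interpret prob_space \<mu> by fact
  interpret C: sigma_finite_measure "count_space P"
    using P by (intro sigma_finite_measure_count_space_finite)
  let ?D = "density (\<mu> \<Otimes>\<^sub>M count_space P) (\<lambda>(s, p). ennreal (q p s))"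
  define \<nu> where "\<nu> = distr ?D N (\<lambda>(s, p). T p s)"
  have meas: "(\<lambda>(s, p). h p s) \<in> \<mu> \<Otimes>\<^sub>M count_space P \<rightarrow>\<^sub>M K" if "\<And>p. p \<in> P \<Longrightarrow> h p \<in> \<mu> \<rightarrow>\<^sub>M K"
    for h :: "'p \<Rightarrow> 's \<Rightarrow> 'k" and K
  proof -
    have "(\<lambda>(p, s). h p s) \<in> count_space P \<Otimes>\<^sub>M \<mu> \<rightarrow>\<^sub>M K"
      using that P by (intro measurable_pair_measure_countable1) (auto intro: countable_finite)
    from measurable_compose[OF measurable_pair_swap' this] show ?thesis by (simp add: case_prod_unfold)
  qed
  have qm: "(\<lambda>(s, p). ennreal (q p s)) \<in> borel_measurable (\<mu> \<Otimes>\<^sub>M count_space P)"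
    using q by (intro meas) measurable
  have Tm: "(\<lambda>(s, p). T p s) \<in> ?D \<rightarrow>\<^sub>M N"
    using meas[OF T] by simp
  have nn: "(\<integral>\<^sup>+x. f x \<partial>\<nu>) = (\<integral>\<^sup>+s. (\<Sum>p\<in>P. ennreal (q p s) * f (T p s)) \<partial>\<mu>)"
    if f: "f \<in> borel_measurable N" for f :: "'t \<Rightarrow> ennreal"
  proof -
    have fT: "(\<lambda>(s, p). f (T p s)) \<in> borel_measurable (\<mu> \<Otimes>\<^sub>M count_space P)"
      using measurable_compose[OF T f] by (intro meas)
    have "(\<integral>\<^sup>+x. f x \<partial>\<nu>) = (\<integral>\<^sup>+z. f ((\<lambda>(s, p). T p s) z) \<partial>?D)"
      unfolding \<nu>_def using f by (subst nn_integral_distr[OF Tm]) auto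
    also have "\<dots> = (\<integral>\<^sup>+z. (\<lambda>(s, p). ennreal (q p s)) z * (\<lambda>(s, p). f (T p s)) z \<partial>(\<mu> \<Otimes>\<^sub>M count_space P))"
      using nn_integral_density[OF qm fT] by (simp add: case_prod_unfold)
    also have "\<dots> = (\<integral>\<^sup>+s. \<integral>\<^sup>+p. ennreal (q p s) * f (T p s) \<partial>count_space P \<partial>\<mu>)"
      using C.nn_integral_fst[OF borel_measurable_times_ennreal[OF qm fT]] by simp
    finally show ?thesis using P by (simp add: nn_integral_count_space_finite)
  qed
  have "emeasure \<nu> (space \<nu>) = (\<integral>\<^sup>+x. 1 \<partial>\<nu>)" by simp
  also have "\<dots> = (\<integral>\<^sup>+s. 1 \<partial>\<mu>)"
  proof (subst nn)
    show "(\<integral>\<^sup>+s. (\<Sum>p\<in>P. ennreal (q p s) * 1) \<partial>\<mu>) = (\<integral>\<^sup>+s. 1 \<partial>\<mu>)"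
      by (intro nn_integral_cong) (simp add: q_nonneg q_sum sum_ennreal)
  qed simp
  also have "\<dots> = 1" by (simp add: emeasure_space_1)
  finally have prob: "prob_space \<nu>" by (rule prob_spaceI)
  have sets: "sets \<nu> = sets N" by (simp add: \<nu>_def)
  have "(\<integral>x. f x \<partial>\<nu>) = (\<integral>s. (\<Sum>p\<in>P. q p s * f (T p s)) \<partial>\<mu>)"
    if f: "f \<in> borel_measurable N" "\<And>x. x \<in> space N \<Longrightarrow> 0 \<le> f x \<and> f x \<le> 1" for f :: "'t \<Rightarrow> real"
  proof -
    have Tsp: "T p s \<in> space N" if "p \<in> P" "s \<in> space \<mu>" for p s
      using measurable_space[OF T] that by auto
    have "(\<integral>x. f x \<partial>\<nu>) = enn2real (\<integral>\<^sup>+x. ennreal (f x) \<partial>\<nu>)"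
      using f by (intro integral_eq_nn_integral)
        (auto simp: measurable_cong_sets[OF sets refl] sets_eq_imp_space_eq[OF sets])
    also have "(\<integral>\<^sup>+x. ennreal (f x) \<partial>\<nu>) = (\<integral>\<^sup>+s. ennreal (\<Sum>p\<in>P. q p s * f (T p s)) \<partial>\<mu>)"
      using f q_nonneg Tsp
      by (subst nn) (auto intro!: nn_integral_cong simp: ennreal_mult sum_ennreal[symmetric])
    also have "enn2real \<dots> = (\<integral>s. (\<Sum>p\<in>P. q p s * f (T p s)) \<partial>\<mu>)"
      using f q_nonneg Tsp q T
      by (intro integral_eq_nn_integral[symmetric] borel_measurable_sum borel_measurable_times
           measurable_compose[OF T] AE_I2 sum_nonneg mult_nonneg_nonneg) auto
    finally show ?thesis .
  qed
  with prob sets show ?thesis by (rule that)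
qed

text \<open>Cesaro averages of the laws of the chain started at 0 are tight, and a weak limit point is
  invariant because the kernel maps continuous functions to continuous functions.\<close>

lemma feller_chain_on_real_has_invariant_distribution:
  fixes T :: "'p \<Rightarrow> real \<Rightarrow> real" and q :: "'p \<Rightarrow> real \<Rightarrow> real"
  assumes P: "finite P"
    and T: "\<And>p. p \<in> P \<Longrightarrow> continuous_on UNIV (T p)" "\<And>p c. p \<in> P \<Longrightarrow> 0 \<le> T p c \<and> T p c \<le> L"
    and q: "\<And>p. p \<in> P \<Longrightarrow> continuous_on UNIV (q p)" "\<And>p c. p \<in> P \<Longrightarrow> 0 \<le> q p c"
    and q_sum: "\<And>c. (\<Sum>p\<in>P. q p c) = 1"
  obtains \<nu> where "real_distribution \<nu>"
    "\<And>f :: real \<Rightarrow> real. f \<in> borel_measurable borel \<Longrightarrow> (\<And>x. 0 \<le> f x \<and> f x \<le> 1) \<Longrightarrow>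
      (\<integral>x. f x \<partial>\<nu>) = (\<integral>c. (\<Sum>p\<in>P. q p c * f (T p c)) \<partial>\<nu>)"
proof -
  have "P \<noteq> {}" using q_sum by auto
  then have L: "0 \<le> L" using T(2) by (metis all_not_in_conv order_trans)
  define Q where "Q f c = (\<Sum>p\<in>P. q p c * f (T p c))" for f :: "real \<Rightarrow> real" and c
  have Q01: "0 \<le> Q f c" "Q f c \<le> 1" if "\<And>x. 0 \<le> f x \<and> f x \<le> 1" for f c
  proof -
    show "0 \<le> Q f c" unfolding Q_def using q that by (intro sum_nonneg) auto
    have "Q f c \<le> (\<Sum>p\<in>P. q p c * 1)" unfolding Q_def using q that by (intro sum_mono mult_left_mono) auto
    then show "Q f c \<le> 1" using q_sum by simp
  qed
  define s where "s c = embed_pmf (\<lambda>p. if p \<in> P then q p c else 0)" for c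
  have pmf_s: "pmf (s c) p = (if p \<in> P then q p c else 0)" for c p
    unfolding s_def
  proof (rule pmf_embed_pmf)
    have "(\<integral>\<^sup>+p. ennreal (if p \<in> P then q p c else 0) \<partial>count_space UNIV) = (\<Sum>p\<in>P. ennreal (q p c))"
      using P by (subst nn_integral_count_space'[of P]) auto
    also have "\<dots> = 1" using q q_sum by (simp add: sum_ennreal)
    finally show "(\<integral>\<^sup>+p. ennreal (if p \<in> P then q p c else 0) \<partial>count_space UNIV) = 1" .
  qed (use q in auto)
  have set_s: "set_pmf (s c) \<subseteq> P" for c by (auto simp: set_pmf_iff pmf_s split: if_splits)
  define K where "K c = map_pmf (\<lambda>p. T p c) (s c)" for c
  have set_K: "finite (set_pmf (K c))" "set_pmf (K c) \<subseteq> {0..L}" for c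
    using finite_subset[OF set_s P] set_s[of c] T(2) by (auto simp: K_def)
  have K_exp: "measure_pmf.expectation (K c) f = Q f c" for c f
  proof -
    have "measure_pmf.expectation (s c) (\<lambda>p. f (T p c)) = (\<Sum>p\<in>P. pmf (s c) p *\<^sub>R f (T p c))"
      using P set_s by (intro integral_measure_pmf) auto
    then show ?thesis by (simp add: K_def Q_def pmf_s)
  qed
  \<comment> \<open>The law after \<open>t\<close> steps from 0. Its support is finite, so
    expectations are finite sums.\<close>
  define m where "m t = ((\<lambda>M. bind_pmf M K) ^^ t) (return_pmf 0)" for t
  have m_Suc: "m (Suc t) = bind_pmf (m t) K" for t by (simp add: m_def)
  have m_set: "finite (set_pmf (m t)) \<and> set_pmf (m t) \<subseteq> {0..L}" for t
  proof (induction t)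
    case 0 then show ?case using L by (simp add: m_def)
  next
    case (Suc t) then show ?case unfolding m_Suc set_bind_pmf using set_K by blast
  qed
  have m_exp: "measure_pmf.expectation (m (Suc t)) f = measure_pmf.expectation (m t) (Q f)" for t and f
    unfolding m_Suc
    using m_set[of t] set_K
    by (subst pmf_expectation_bind[of "set_pmf (m t)"])
      (auto simp: K_exp integral_measure_pmf[of "set_pmf (m t)"])
  \<comment> \<open>A time drawn uniformly from 0 to \<open>n\<close> gives the Cesaro average of
    \<open>n + 1\<close> laws.\<close>
  define a where "a n = bind_pmf (pmf_of_set {..n}) m" for n :: nat
  have a_exp: "measure_pmf.expectation (a n) f = (\<Sum>t\<le>n. measure_pmf.expectation (m t) f) / (1 + real n)"
    for n and f :: "real \<Rightarrow> real"
    unfolding a_def using m_set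
    by (subst pmf_expectation_bind_pmf_of_set) (auto simp: sum_divide_distrib sum_distrib_left divide_inverse_commute)
  have a_set: "set_pmf (a n) \<subseteq> {0..L}" for n
    using m_set by (auto simp: a_def)
  have m_bd: "0 \<le> measure_pmf.expectation (m t) f" "measure_pmf.expectation (m t) f \<le> 1"
    if "\<And>x. 0 \<le> f x \<and> f x \<le> 1" for t and f :: "real \<Rightarrow> real"
  proof -
    show "0 \<le> measure_pmf.expectation (m t) f" using that by (intro Bochner_Integration.integral_nonneg) auto
    have "measure_pmf.expectation (m t) f \<le> measure_pmf.expectation (m t) (\<lambda>_. 1)"
      using that m_set[of t] by (intro integral_mono integrable_measure_pmf_finite) auto
    then show "measure_pmf.expectation (m t) f \<le> 1" by simp
  qed
  \<comment> \<open>The one-step changes telescope to two expectations between 0 and 1.\<close>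
  have a_inv: "\<bar>measure_pmf.expectation (a n) (Q f) - measure_pmf.expectation (a n) f\<bar> \<le> 1 / (1 + real n)"
    if f: "\<And>x. 0 \<le> f x \<and> f x \<le> 1" for n f
  proof -
    let ?E = "\<lambda>t. measure_pmf.expectation (m t) f"
    have "measure_pmf.expectation (a n) (Q f) - measure_pmf.expectation (a n) f
      = ((\<Sum>t\<le>n. ?E (Suc t) - ?E t)) / (1 + real n)"
      by (simp add: a_exp m_exp sum_subtractf diff_divide_distrib)
    also have "(\<Sum>t\<le>n. ?E (Suc t) - ?E t) = ?E (Suc n) - ?E 0"
      using sum_lessThan_telescope[of ?E "Suc n"] by (simp add: lessThan_Suc_atMost)
    finally show ?thesis using m_bd[of f "Suc n", OF f] m_bd[of f 0, OF f]
      by (auto simp: abs_divide intro!: divide_right_mono)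
  qed
  define \<mu> where "\<mu> n = distr (measure_pmf (a n)) borel (\<lambda>x. x)" for n
  have \<mu>_rd: "real_distribution (\<mu> n)" for n
    unfolding \<mu>_def by (intro prob_space.real_distribution_distr measure_pmf.prob_space_axioms) auto
  have \<mu>_exp: "(\<integral>x. f x \<partial>\<mu> n) = measure_pmf.expectation (a n) f"
    if "f \<in> borel_measurable borel" for f :: "real \<Rightarrow> real" and n
    unfolding \<mu>_def using that by (subst integral_distr) auto
  \<comment> \<open>Tightness is stated with intervals open on the left, hence -1 as the left
    end.\<close>
  have "measure (\<mu> n) {-1<..L} = 1" for n
  proof -
    have "measure (\<mu> n) {-1<..L} = measure (measure_pmf (a n)) {-1<..L}"
      unfolding \<mu>_def by (subst measure_distr) auto
    also have "\<dots> = 1"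
      using a_set[of n] by (intro measure_pmf.prob_eq_1[THEN iffD2]) (auto simp: AE_measure_pmf_iff)
    finally show ?thesis .
  qed
  then have "tight \<mu>"
    unfolding tight_def using \<mu>_rd L
    by (intro conjI allI impI exI[of _ "-1 :: real"] exI[of _ L]) auto
  from tight_imp_convergent_subsubsequence[OF this strict_mono_id]
  obtain r \<nu> where r: "strict_mono (r :: nat \<Rightarrow> nat)" and \<nu>: "real_distribution \<nu>" and "weak_conv_m (\<mu> \<circ> id \<circ> r) \<nu>"
    by auto
  then have conv: "weak_conv_m (\<lambda>k. \<mu> (r k)) \<nu>" by (simp add: o_def id_def)
  interpret \<nu>: real_distribution \<nu> by fact
  have lim: "(\<lambda>k. measure_pmf.expectation (a (r k)) f) \<longlonglongrightarrow> (\<integral>x. f x \<partial>\<nu>)"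
    if f: "continuous_on UNIV f" "\<And>x. 0 \<le> f x \<and> f x \<le> 1" for f :: "real \<Rightarrow> real"
  proof -
    have "(\<lambda>k. \<integral>x. f x \<partial>\<mu> (r k)) \<longlonglongrightarrow> (\<integral>x. f x \<partial>\<nu>)"
      by (rule weak_conv_imp_integral_bdd_continuous_conv[OF \<mu>_rd \<nu> conv, where B=1])
        (use f in \<open>auto simp: continuous_on_eq_continuous_at\<close>)
    then show ?thesis using f by (simp add: \<mu>_exp borel_measurable_continuous_onI)
  qed
  have Qcont: "continuous_on UNIV (Q f)" if "continuous_on UNIV f" for f
    unfolding Q_def using T q
    by (intro continuous_intros continuous_on_compose2[OF that]) auto
  have inv_cont: "(\<integral>x. Q f x \<partial>\<nu>) = (\<integral>x. f x \<partial>\<nu>)"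
    if f: "continuous_on UNIV f" "\<And>x. 0 \<le> f x \<and> f x \<le> 1" for f
  proof (rule LIMSEQ_unique[OF lim])
    have "(\<lambda>k. measure_pmf.expectation (a (r k)) (Q f) - measure_pmf.expectation (a (r k)) f) \<longlonglongrightarrow> 0"
    proof (rule Lim_null_comparison)
      show "\<forall>\<^sub>F k in sequentially. norm (measure_pmf.expectation (a (r k)) (Q f) - measure_pmf.expectation (a (r k)) f) \<le> 1 / (1 + real k)"
      proof (rule always_eventually, rule allI)
        fix k
        have "1 / (1 + real (r k)) \<le> 1 / (1 + real k)"
          using seq_suble[OF r, of k] by (intro divide_left_mono) auto
        with a_inv[of f "r k", OF f(2)]
        show "norm (measure_pmf.expectation (a (r k)) (Q f) - measure_pmf.expectation (a (r k)) f) \<le> 1 / (1 + real k)"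
          by simp
      qed
      show "(\<lambda>k. 1 / (1 + real k)) \<longlonglongrightarrow> 0" using LIMSEQ_inverse_real_of_nat by (simp add: field_simps)
    qed
    from tendsto_add[OF this lim[OF f]]
    show "(\<lambda>k. measure_pmf.expectation (a (r k)) (Q f)) \<longlonglongrightarrow> (\<integral>x. f x \<partial>\<nu>)" by simp
  qed (use Qcont Q01 f in auto)
  have Tm: "T p \<in> \<nu> \<rightarrow>\<^sub>M borel" and qm: "q p \<in> borel_measurable \<nu>" if "p \<in> P" for p
    using T(1)[OF that] q(1)[OF that]
    by (simp_all add: measurable_cong_sets[OF \<nu>.events_eq_borel refl] borel_measurable_continuous_onI)
  \<comment> \<open>So far \<open>\<nu>\<close> is invariant only against continuous functions. The
    law \<open>\<nu>'\<close> one step later integrates these alike; once it is identified with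
    \<open>\<nu>\<close>, invariance holds against measurable functions too.\<close>
  obtain \<nu>' where \<nu>': "prob_space \<nu>'" "sets \<nu>' = sets (borel :: real measure)"
    "\<And>f :: real \<Rightarrow> real. f \<in> borel_measurable borel \<Longrightarrow> (\<And>x. x \<in> space borel \<Longrightarrow> 0 \<le> f x \<and> f x \<le> 1) \<Longrightarrow>
      (\<integral>x. f x \<partial>\<nu>') = (\<integral>s. (\<Sum>p\<in>P. q p s * f (T p s)) \<partial>\<nu>)"
    by (rule one_step_law[OF \<nu>.prob_space_axioms P qm Tm]) (use q(2) q_sum in auto)
  have rd': "real_distribution \<nu>'" using \<nu>' by (simp add: real_distribution_def real_distribution_axioms_def)
  \<comment> \<open>Agreement on continuous step functions makes the constant sequence converge
    weakly to \<open>\<nu>'\<close>, and characteristic functions then identify the two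
    laws.\<close>
  have "weak_conv_m (\<lambda>_. \<nu>) \<nu>'"
  proof (rule integral_cts_step_conv_imp_weak_conv[OF \<nu> rd'])
    fix x y :: real assume "x < y"
    have c: "continuous_on UNIV (cts_step x y)"
      using cts_step_uniformly_continuous[OF \<open>x < y\<close>] by (rule uniformly_continuous_imp_continuous)
    have b: "0 \<le> cts_step x y z \<and> cts_step x y z \<le> 1" for z
      using \<open>x < y\<close> by (auto simp: cts_step_def)
    have "(\<integral>z. cts_step x y z \<partial>\<nu>') = (\<integral>z. cts_step x y z \<partial>\<nu>)"
      using \<nu>'(3)[OF borel_measurable_continuous_onI[OF c]] b inv_cont[OF c b] by (simp add: Q_def)
    then show "(\<lambda>n. integral\<^sup>L \<nu> (cts_step x y)) \<longlonglongrightarrow> integral\<^sup>L \<nu>' (cts_step x y)" by simp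
  qed
  then have "char \<nu> t = char \<nu>' t" for t
    using levy_continuity1[OF \<nu> rd', of t] LIMSEQ_unique tendsto_const by blast
  then have "\<nu> = \<nu>'" using Levy_uniqueness[OF \<nu> rd'] by blast
  then show ?thesis using that[OF \<nu>] \<nu>'(3) by auto
qed

section \<open>Existence of invariant laws for the learning dynamics\<close>

definition mixed :: "('i \<Rightarrow> 'a set) \<Rightarrow> ('i \<Rightarrow> 'a \<Rightarrow> real) set" where
  "mixed A = {x. \<forall>i. (\<forall>b. x i b \<ge> 0) \<and> (\<forall>b. b \<notin> A i \<longrightarrow> x i b = 0) \<and> sum (x i) (A i) = 1}"

text \<open>The strategy half of \<open>next_state\<close>. Neither it nor \<open>sel_prob\<close>
  depends on the previous action profile, so the strategies form a Markov chain by
  themselves.\<close>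

definition update :: "('i \<Rightarrow> ('i \<Rightarrow> 'a) \<Rightarrow> real) \<Rightarrow> real \<Rightarrow> ('i \<Rightarrow> 'a) \<Rightarrow> ('i \<Rightarrow> 'a \<Rightarrow> real) \<Rightarrow> 'i \<Rightarrow> 'a \<Rightarrow> real" where
  "update u \<epsilon> \<alpha> x = (\<lambda>i b. x i b + \<epsilon> * u i \<alpha> * (unitv (\<alpha> i) b - x i b))"

lemma next_state_eq: "next_state u \<epsilon> s \<alpha> = (\<alpha>, update u \<epsilon> \<alpha> (snd s))"
  by (simp add: next_state_def update_def)

lemma states_eq: "states A = profiles A \<times> mixed A"
  by (auto simp: states_def mixed_def)

lemma pure_mixed: "\<alpha> \<in> profiles A \<Longrightarrow> (\<lambda>i. unitv (\<alpha> i)) \<in> mixed A"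
  for A :: "'i \<Rightarrow> 'a::finite set"
  by (auto simp: mixed_def profiles_def unitv_def)

lemma mixed_le_1: "x i b \<le> 1" if "x \<in> mixed A" for A :: "'i \<Rightarrow> 'a::finite set"
proof (cases "b \<in> A i")
  case True
  then have "x i b \<le> sum (x i) (A i)" using that by (intro member_le_sum) (auto simp: mixed_def)
  then show ?thesis using that by (simp add: mixed_def)
qed (use that in \<open>auto simp: mixed_def\<close>)

lemma sum_prod_profiles:
  fixes A :: "'i::finite \<Rightarrow> 'a::finite set" and f :: "'i \<Rightarrow> 'a \<Rightarrow> real"
  shows "(\<Sum>\<alpha>\<in>profiles A. \<Prod>i\<in>UNIV. f i (\<alpha> i)) = (\<Prod>i\<in>UNIV. \<Sum>a\<in>A i. f i a)"
proof -
  have "profiles A = PiE UNIV A" by (auto simp: profiles_def)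
  then show ?thesis by (simp add: prod_sum_PiE)
qed

lemma continuous_coordinate:
  fixes f :: "'c::topological_space \<Rightarrow> 'i \<Rightarrow> 'a \<Rightarrow> real"
  assumes "continuous_on S f"
  shows "continuous_on S (\<lambda>x. f x i b)"
  by (rule continuous_on_product_then_coordinatewise[OF continuous_on_product_then_coordinatewise[OF assms]])

lemma continuous_update:
  fixes f :: "'c::topological_space \<Rightarrow> 'i \<Rightarrow> 'a \<Rightarrow> real"
  assumes "continuous_on S f"
  shows "continuous_on S (\<lambda>x. update u \<epsilon> \<alpha> (f x))"
  unfolding update_def
  by (intro continuous_on_coordinatewise_then_product continuous_intros continuous_coordinate[OF assms])

lemma continuous_sel_prob:
  fixes f :: "'c::topological_space \<Rightarrow> 'i::finite \<Rightarrow> 'a \<Rightarrow> real"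
  assumes "continuous_on S f"
  shows "continuous_on S (\<lambda>x. sel_prob A lam (\<beta>, f x) \<alpha>)"
  unfolding sel_prob_def snd_conv by (intro continuous_intros continuous_coordinate[OF assms])

lemma space_state_measure [simp]: "space (state_measure A) = states A"
  by (simp add: state_measure_def space_restrict_space space_pair_measure)

lemma measurable_continuous_snd_state:
  assumes "continuous_on UNIV f"
  shows "(\<lambda>s. f (snd s)) \<in> state_measure A \<rightarrow>\<^sub>M borel"
  unfolding state_measure_def
  by (intro measurable_restrict_space1 measurable_compose[OF measurable_snd]
      borel_measurable_continuous_onI assms)

lemma measurable_into_state_measure:
  assumes "g \<in> M \<rightarrow>\<^sub>M borel" "\<And>c. c \<in> space M \<Longrightarrow> g c \<in> mixed A" "\<alpha> \<in> profiles A"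
  shows "(\<lambda>c. (\<alpha>, g c)) \<in> M \<rightarrow>\<^sub>M state_measure A"
  unfolding state_measure_def using assms
  by (intro measurable_restrict_space2 measurable_Pair) (auto simp: states_eq)

locale learning_automata =
  fixes A :: "'i::finite \<Rightarrow> 'a::finite set"
    and u :: "'i \<Rightarrow> ('i \<Rightarrow> 'a) \<Rightarrow> real"
    and \<epsilon> :: real
  assumes nonempty: "A i \<noteq> {}"
    and step: "admissible_step A u \<epsilon>"
begin

lemma rate: "\<alpha> \<in> profiles A \<Longrightarrow> 0 < \<epsilon> * u i \<alpha> \<and> \<epsilon> * u i \<alpha> < 1"
  using step by (simp add: admissible_step_def)

lemma profiles_nonempty: "profiles A \<noteq> {}"
proof -
  have "(\<lambda>i. SOME a. a \<in> A i) \<in> profiles A"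
    using nonempty by (auto simp: profiles_def some_in_eq)
  then show ?thesis by auto
qed

text \<open>A minimum over finitely many rates. It yields the contraction factor
  \<open>1 - \<delta>\<close> of the updates and, later, the guaranteed gain of the probability of
  staying on an edge.\<close>

lemma uniform_rate:
  obtains \<delta> where "0 < \<delta>" "\<delta> < 1" "\<And>i \<alpha>. \<alpha> \<in> profiles A \<Longrightarrow> \<delta> \<le> \<epsilon> * u i \<alpha>"
proof -
  let ?R = "(\<lambda>(i, \<alpha>). \<epsilon> * u i \<alpha>) ` (UNIV \<times> profiles A)"
  have R: "finite ?R" "?R \<noteq> {}" using profiles_nonempty by auto
  show ?thesis
  proof (rule that[of "Min ?R"])
    show "0 < Min ?R" "Min ?R < 1" using Min_in[OF R] rate by auto
    show "Min ?R \<le> \<epsilon> * u i \<alpha>" if "\<alpha> \<in> profiles A" for i \<alpha>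
      using R that by (intro Min_le) auto
  qed
qed

lemma update_mixed:
  assumes "x \<in> mixed A" "\<alpha> \<in> profiles A"
  shows "update u \<epsilon> \<alpha> x \<in> mixed A"
proof -
  have e: "update u \<epsilon> \<alpha> x i b = (1 - \<epsilon> * u i \<alpha>) * x i b + \<epsilon> * u i \<alpha> * unitv (\<alpha> i) b" for i b
    by (simp add: update_def algebra_simps)
  have "sum (update u \<epsilon> \<alpha> x i) (A i) = (1 - \<epsilon> * u i \<alpha>) * sum (x i) (A i) + \<epsilon> * u i \<alpha> * sum (unitv (\<alpha> i)) (A i)" for i
    by (simp add: e sum.distrib sum_distrib_left)
  then show ?thesis
    using assms(1) pure_mixed[OF assms(2)] rate[OF assms(2)]
    by (auto simp: mixed_def e less_imp_le)
qed

lemma sel_prob_nonneg: "x \<in> mixed A \<Longrightarrow> 0 \<le> lam \<Longrightarrow> lam \<le> 1 \<Longrightarrow> 0 \<le> sel_prob A lam (\<beta>, x) \<alpha>"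
  unfolding sel_prob_def by (intro prod_nonneg) (auto simp: mixed_def)

lemma sum_sel_prob:
  assumes "x \<in> mixed A" shows "(\<Sum>\<alpha>\<in>profiles A. sel_prob A lam (\<beta>, x) \<alpha>) = 1"
proof -
  have "(\<Sum>a\<in>A i. (1 - lam) * x i a + lam / real (card (A i))) = 1" for i
    using assms nonempty[of i] by (simp add: sum.distrib mixed_def flip: sum_distrib_left)
  then show ?thesis
    unfolding sel_prob_def snd_conv
    by (subst sum_prod_profiles[where f="\<lambda>i a. (1 - lam) * x i a + lam / real (card (A i))"]) simp
qed

lemma sel_prob_measurable: "(\<lambda>s. sel_prob A lam s \<alpha>) \<in> borel_measurable (state_measure A)"
  using measurable_continuous_snd_state[OF continuous_sel_prob[OF continuous_on_id]]
  by (simp add: sel_prob_def)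

lemma next_state_measurable:
  assumes "\<alpha> \<in> profiles A"
  shows "(\<lambda>s. next_state u \<epsilon> s \<alpha>) \<in> state_measure A \<rightarrow>\<^sub>M state_measure A"
  unfolding next_state_eq using assms update_mixed
  by (intro measurable_into_state_measure measurable_continuous_snd_state continuous_update[OF continuous_on_id])
    (auto simp: states_eq)

text \<open>Under a fixed profile all strategies are pulled towards the same vertices, so
  \<open>update\<close> contracts by the factor \<open>1 - \<delta>\<close>. The number
  \<open>c\<close> stands for a history, \<open>T \<alpha>\<close> adds \<open>\<alpha>\<close> to
  it, and \<open>Z\<close> reads off the resulting strategies.\<close>

lemma history_coding:
  obtains T :: "('i \<Rightarrow> 'a) \<Rightarrow> real \<Rightarrow> real" and L :: real and Z :: "real \<Rightarrow> 'i \<Rightarrow> 'a \<Rightarrow> real"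
  where "\<And>\<alpha>. continuous_on UNIV (T \<alpha>)" "\<And>\<alpha> c. \<alpha> \<in> profiles A \<Longrightarrow> 0 \<le> T \<alpha> c \<and> T \<alpha> c \<le> L"
    "continuous_on UNIV Z" "\<And>c. Z c \<in> mixed A"
    "\<And>\<alpha> c. \<alpha> \<in> profiles A \<Longrightarrow> Z (T \<alpha> c) = update u \<epsilon> \<alpha> (Z c)"
proof -
  obtain \<delta> where \<delta>: "0 < \<delta>" "\<delta> < 1" "\<And>i \<alpha>. \<alpha> \<in> profiles A \<Longrightarrow> \<delta> \<le> \<epsilon> * u i \<alpha>"
    using uniform_rate by blast
  \<comment> \<open>\<open>V\<close> and \<open>W\<close> pass between functions and Euclidean
    vectors, where the contraction can be measured by a norm.\<close>
  define V where "V x = (\<chi> i b. x i b)" for x :: "'i \<Rightarrow> 'a \<Rightarrow> real"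
  define W where "W v = (\<lambda>i b. v $ i $ b)" for v :: "real ^ 'a ^ 'i"
  define S where "S = {v. W v \<in> mixed A}"
  have WV: "W (V x) = x" for x by (simp add: V_def W_def)
  define N where "N = card (profiles A)"
  have N: "0 < N" using profiles_nonempty by (simp add: N_def card_gt_0_iff)
  obtain h where h: "bij_betw h {..<N} (profiles A)"
    using ex_bij_betw_nat_finite[of "profiles A"] by (auto simp: N_def atLeast0LessThan)
  then have hP: "h d \<in> profiles A" if "d < N" for d using that by (auto simp: bij_betw_def)
  have "closed S"
  proof -
    have "S = {v. \<forall>i. (\<forall>b. 0 \<le> v $ i $ b) \<and> (\<forall>b. b \<notin> A i \<longrightarrow> v $ i $ b = 0) \<and> (\<Sum>b\<in>A i. v $ i $ b) = 1}"
      by (auto simp: S_def W_def mixed_def)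
    also have "closed \<dots>"
      by (intro closed_Collect_all closed_Collect_conj closed_Collect_imp closed_Collect_le closed_Collect_eq
          continuous_intros) auto
    finally show ?thesis .
  qed
  moreover have "convex S"
    unfolding convex_def
    by (auto simp: S_def W_def mixed_def sum.distrib simp flip: sum_distrib_left)
  moreover have "bounded S"
  proof (rule boundedI)
    fix v assume "v \<in> S"
    then have v: "\<bar>v $ i $ b\<bar> \<le> 1" for i b
      using mixed_le_1[of "W v" A i b] by (auto simp: S_def W_def mixed_def)
    have "norm v \<le> (\<Sum>i\<in>UNIV. norm (v $ i))" unfolding norm_vec_def by (rule L2_set_le_sum) auto
    also have "\<dots> \<le> (\<Sum>i\<in>(UNIV :: 'i set). \<Sum>b\<in>(UNIV :: 'a set). 1)"
      using v by (intro sum_mono order_trans[OF norm_le_l1_cart]) auto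
    finally show "norm v \<le> (\<Sum>i\<in>(UNIV :: 'i set). \<Sum>b\<in>(UNIV :: 'a set). 1)" .
  qed
  moreover have "S \<noteq> {}"
  proof -
    obtain \<alpha> where "\<alpha> \<in> profiles A" using profiles_nonempty by auto
    then have "V (\<lambda>i. unitv (\<alpha> i)) \<in> S" by (simp add: S_def WV pure_mixed)
    then show ?thesis by auto
  qed
  moreover have "0 \<le> 1 - \<delta>" "1 - \<delta> < 1" using \<delta> by auto
  moreover have "V (update u \<epsilon> (h d) (W v)) \<in> S" if "d < N" "v \<in> S" for d v
    using update_mixed hP[OF that(1)] that(2) by (simp add: S_def WV)
  moreover have "dist (V (update u \<epsilon> (h d) (W v))) (V (update u \<epsilon> (h d) (W w))) \<le> (1 - \<delta>) * dist v w"
    if "d < N" for d v w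
  proof -
    \<comment> \<open>The vertex pulled to is common to both strategies and cancels.\<close>
    have *: "(V (update u \<epsilon> (h d) (W v)) - V (update u \<epsilon> (h d) (W w))) $ i
      = (1 - \<epsilon> * u i (h d)) *\<^sub>R ((v - w) $ i)" for i
      by (simp add: vec_eq_iff V_def W_def update_def algebra_simps)
    have "norm (V (update u \<epsilon> (h d) (W v)) - V (update u \<epsilon> (h d) (W w)))
      = L2_set (\<lambda>i. norm ((1 - \<epsilon> * u i (h d)) *\<^sub>R ((v - w) $ i))) UNIV"
      unfolding norm_vec_def[of "V (update u \<epsilon> (h d) (W v)) - V (update u \<epsilon> (h d) (W w))"] * ..
    also have "\<dots> \<le> L2_set (\<lambda>i. (1 - \<delta>) * norm ((v - w) $ i)) UNIV"
    proof (rule L2_set_mono)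
      fix i
      have "\<bar>1 - \<epsilon> * u i (h d)\<bar> \<le> 1 - \<delta>" using \<delta>(3)[OF hP[OF that], of i] rate[OF hP[OF that], of i] by auto
      then show "norm ((1 - \<epsilon> * u i (h d)) *\<^sub>R ((v - w) $ i)) \<le> (1 - \<delta>) * norm ((v - w) $ i)"
        by (simp add: mult_right_mono)
    qed auto
    also have "\<dots> = (1 - \<delta>) * norm (v - w)"
      using \<delta> by (simp add: norm_vec_def L2_set_right_distrib)
    finally show ?thesis by (simp add: dist_norm)
  qed
  ultimately obtain T Z where TZ: "\<And>d. continuous_on UNIV (T d)"
    "\<And>d c. d < N \<Longrightarrow> 0 \<le> T d c \<and> T d c \<le> 2 * real N"
    "continuous_on UNIV Z" "\<And>c. Z c \<in> S" "\<And>d c. d < N \<Longrightarrow> Z (T d c) = V (update u \<epsilon> (h d) (W (Z c)))"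
    using contractive_ifs_real_coding[of S "1 - \<delta>" N "\<lambda>d v. V (update u \<epsilon> (h d) (W v))"] N by blast
  define k where "k = the_inv_into {..<N} h"
  have k: "k \<alpha> < N" "h (k \<alpha>) = \<alpha>" if "\<alpha> \<in> profiles A" for \<alpha>
  proof -
    have "inj_on h {..<N}" "\<alpha> \<in> h ` {..<N}" using h that by (auto simp: bij_betw_def)
    then show "k \<alpha> < N" "h (k \<alpha>) = \<alpha>"
      unfolding k_def using the_inv_into_into[of h "{..<N}" \<alpha>] f_the_inv_into_f[of h "{..<N}" \<alpha>] by auto
  qed
  show ?thesis
  proof (rule that[of "\<lambda>\<alpha>. T (k \<alpha>)" "2 * real N" "\<lambda>c. W (Z c)"])
    show "continuous_on UNIV (\<lambda>c. W (Z c))"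
      unfolding W_def using TZ(3) by (intro continuous_on_coordinatewise_then_product continuous_intros)
  qed (use TZ k in \<open>auto simp: S_def WV\<close>)
qed

text \<open>The coded chain on the line has an invariant law \<open>\<nu>\<close>. The law
  \<open>\<mu>\<close> of the drawn profile together with the strategies read off from the new code
  is then invariant for the learning dynamics.\<close>

theorem invariant_pm_exists:
  assumes lam: "0 \<le> lam" "lam \<le> 1"
  shows "\<exists>\<mu>. invariant_pm A u \<epsilon> lam \<mu>"
proof -
  obtain T :: "('i \<Rightarrow> 'a) \<Rightarrow> real \<Rightarrow> real" and L :: real and Z :: "real \<Rightarrow> 'i \<Rightarrow> 'a \<Rightarrow> real"
    where T: "\<And>\<alpha>. continuous_on UNIV (T \<alpha>)" "\<And>\<alpha> c. \<alpha> \<in> profiles A \<Longrightarrow> 0 \<le> T \<alpha> c \<and> T \<alpha> c \<le> L"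
    and Z: "continuous_on UNIV Z" "\<And>c. Z c \<in> mixed A"
    "\<And>\<alpha> c. \<alpha> \<in> profiles A \<Longrightarrow> Z (T \<alpha> c) = update u \<epsilon> \<alpha> (Z c)"
    by (rule history_coding) (rule that)
  \<comment> \<open>Any profile serves here, as selection probabilities depend on the strategies
    alone.\<close>
  obtain \<alpha>0 where \<alpha>0: "\<alpha>0 \<in> profiles A" using profiles_nonempty by auto
  define q where "q \<alpha> c = sel_prob A lam (\<alpha>0, Z c) \<alpha>" for \<alpha> c
  have q: "continuous_on UNIV (q \<alpha>)" "0 \<le> q \<alpha> c" "(\<Sum>\<alpha>\<in>profiles A. q \<alpha> c) = 1" for \<alpha> c
    unfolding q_def using sel_prob_nonneg[OF Z(2) lam] sum_sel_prob[OF Z(2)]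
    by (auto intro!: continuous_sel_prob Z)
  have fin: "finite (profiles A)" by simp
  obtain \<nu> where \<nu>: "real_distribution \<nu>"
    "\<And>f :: real \<Rightarrow> real. f \<in> borel_measurable borel \<Longrightarrow> (\<And>x. 0 \<le> f x \<and> f x \<le> 1) \<Longrightarrow>
      (\<integral>x. f x \<partial>\<nu>) = (\<integral>c. (\<Sum>\<alpha>\<in>profiles A. q \<alpha> c * f (T \<alpha> c)) \<partial>\<nu>)"
    by (rule feller_chain_on_real_has_invariant_distribution[where T=T, OF fin T q], assumption) (rule that; blast)
  interpret \<nu>: real_distribution \<nu> by fact
  have Zm: "(\<lambda>c. (\<alpha>, Z (f c))) \<in> borel \<rightarrow>\<^sub>M state_measure A"
    if "\<alpha> \<in> profiles A" "continuous_on UNIV f" for \<alpha> and f :: "real \<Rightarrow> real"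
    using that Z(2) by (intro measurable_into_state_measure borel_measurable_continuous_onI
        continuous_on_compose2[OF Z(1)]) auto
  have qm: "q \<alpha> \<in> borel_measurable \<nu>" for \<alpha>
    using borel_measurable_continuous_onI[OF q(1)] by (simp add: measurable_cong_sets[OF \<nu>.events_eq_borel refl])
  have ZTm: "(\<lambda>c. (\<alpha>, Z (T \<alpha> c))) \<in> \<nu> \<rightarrow>\<^sub>M state_measure A" if "\<alpha> \<in> profiles A" for \<alpha>
    using Zm[OF that T(1)] by (simp add: measurable_cong_sets[OF \<nu>.events_eq_borel refl])
  obtain \<mu> where \<mu>: "prob_space \<mu>" "sets \<mu> = sets (state_measure A)"
    and \<mu>_int: "\<And>f :: _ \<Rightarrow> real. f \<in> borel_measurable (state_measure A) \<Longrightarrow>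
      (\<And>x. x \<in> space (state_measure A) \<Longrightarrow> 0 \<le> f x \<and> f x \<le> 1) \<Longrightarrow>
      (\<integral>x. f x \<partial>\<mu>) = (\<integral>c. (\<Sum>\<alpha>\<in>profiles A. q \<alpha> c * f (\<alpha>, Z (T \<alpha> c))) \<partial>\<nu>)"
    by (rule one_step_law[where T="\<lambda>\<alpha> c. (\<alpha>, Z (T \<alpha> c))", OF \<nu>.prob_space_axioms fin qm ZTm q(2) q(3)], assumption)
      (rule that; blast)
  have "measure \<mu> B = (\<integral>s. (\<Sum>\<alpha>' \<in> profiles A. sel_prob A lam s \<alpha>' * indicator B (next_state u \<epsilon> s \<alpha>')) \<partial>\<mu>)"
    if B: "B \<in> sets (state_measure A)" for B
  proof -
    define g where "g s = (\<Sum>\<alpha>' \<in> profiles A. sel_prob A lam s \<alpha>' * indicator B (next_state u \<epsilon> s \<alpha>'))"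
      for s :: "('i \<Rightarrow> 'a) \<times> ('i \<Rightarrow> 'a \<Rightarrow> real)"
    have ind: "indicator B \<in> borel_measurable (state_measure A)" using B by simp
    have gm: "g \<in> borel_measurable (state_measure A)"
      unfolding g_def
      by (intro borel_measurable_sum borel_measurable_times sel_prob_measurable
          measurable_compose[OF next_state_measurable ind])
    have g01: "0 \<le> g s \<and> g s \<le> 1" if "s \<in> states A" for s
    proof (intro conjI)
      obtain \<beta> x where s: "s = (\<beta>, x)" "x \<in> mixed A" using \<open>s \<in> states A\<close> by (auto simp: states_eq)
      show "0 \<le> g s" unfolding g_def s(1) using sel_prob_nonneg[OF s(2) lam] by (intro sum_nonneg) auto
      have "g s \<le> (\<Sum>\<alpha>' \<in> profiles A. sel_prob A lam s \<alpha>')"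
        unfolding g_def s(1) using sel_prob_nonneg[OF s(2) lam]
        by (intro sum_mono) (auto simp: indicator_def)
      then show "g s \<le> 1" using sum_sel_prob[OF s(2)] s(1) by simp
    qed
    have g_snd: "g (\<alpha>, x) = g (\<alpha>0, x)" for \<alpha> x
      by (simp add: g_def sel_prob_def next_state_def)
    have "(\<integral>s. g s \<partial>\<mu>) = (\<integral>c. (\<Sum>\<alpha>\<in>profiles A. q \<alpha> c * g (\<alpha>, Z (T \<alpha> c))) \<partial>\<nu>)"
      using \<mu>_int[OF gm] g01 by simp
    also have "\<dots> = (\<integral>c. (\<Sum>\<alpha>\<in>profiles A. q \<alpha> c * g (\<alpha>0, Z (T \<alpha> c))) \<partial>\<nu>)"
      by (intro Bochner_Integration.integral_cong sum.cong refl arg_cong2[where f="(*)"] g_snd)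
    \<comment> \<open>Invariance of \<open>\<nu>\<close> removes the step built into
      \<open>\<mu>\<close>; expanding \<open>g\<close> takes one step again and leads back to
      \<open>\<mu>\<close>.\<close>
    also have "\<dots> = (\<integral>c. g (\<alpha>0, Z c) \<partial>\<nu>)"
      using \<nu>(2)[of "\<lambda>c. g (\<alpha>0, Z c)"] measurable_compose[OF Zm[OF \<alpha>0, of "\<lambda>x. x"] gm] g01 \<alpha>0 Z(2)
      by (simp add: states_eq)
    also have "\<dots> = (\<integral>c. (\<Sum>\<alpha>\<in>profiles A. q \<alpha> c * indicator B (\<alpha>, Z (T \<alpha> c))) \<partial>\<nu>)"
      by (simp add: g_def q_def next_state_eq Z(3))
    also have "\<dots> = (\<integral>x. indicator B x \<partial>\<mu>)"
      using \<mu>_int[OF ind] by simp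
    also have "\<dots> = measure \<mu> B"
      using sets.sets_into_space[of B \<mu>] B \<mu> by (simp add: Int_absorb2)
    finally show ?thesis unfolding g_def by simp
  qed
  with \<mu> show ?thesis by (intro exI[of _ \<mu>]) (auto simp: invariant_pm_def)
qed

end

section \<open>First-order expansion in the perturbation\<close>

text \<open>In the expanded product all terms are nonnegative, and only those with at most one
  factor \<open>b i\<close> are kept. With \<open>b\<close> of the order of the perturbation these
  are the outcomes with at most one tremble.\<close>

lemma prod_add_ge_linear_part:
  fixes a b :: "'i \<Rightarrow> real"
  assumes "finite I" "\<And>i. i \<in> I \<Longrightarrow> 0 \<le> a i" "\<And>i. i \<in> I \<Longrightarrow> 0 \<le> b i"
  shows "(\<Prod>i\<in>I. a i) + (\<Sum>i\<in>I. b i * (\<Prod>j\<in>I - {i}. a j)) \<le> (\<Prod>i\<in>I. a i + b i)"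
  using assms
proof (induction I rule: finite_induct)
  case (insert k I)
  let ?p = "\<lambda>I. \<Prod>i\<in>I. a i" and ?q = "\<Prod>i\<in>I. a i + b i"
  have IH: "?p I + (\<Sum>i\<in>I. b i * ?p (I - {i})) \<le> ?q" using insert by auto
  have "?p I \<le> ?q" using insert by (intro prod_mono) auto
  have rem: "?p (insert k I - {i}) = a k * ?p (I - {i})" if "i \<in> I" for i
  proof -
    have "insert k I - {i} = insert k (I - {i})" using that insert by auto
    then show ?thesis using insert by simp
  qed
  have "(\<Sum>i\<in>insert k I. b i * ?p (insert k I - {i})) = b k * ?p I + a k * (\<Sum>i\<in>I. b i * ?p (I - {i}))"
    using insert by (simp add: rem sum_distrib_left mult.left_commute)
  then have "?p (insert k I) + (\<Sum>i\<in>insert k I. b i * ?p (insert k I - {i}))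
    = a k * (?p I + (\<Sum>i\<in>I. b i * ?p (I - {i}))) + b k * ?p I"
    using insert by (simp add: algebra_simps)
  also have "\<dots> \<le> a k * ?q + b k * ?q"
    using IH \<open>?p I \<le> ?q\<close> insert by (intro add_mono mult_left_mono) auto
  finally show ?case using insert by (simp add: algebra_simps)
qed simp

lemma test_fun_snd:
  assumes "continuous_on UNIV f" "\<And>x. x \<in> mixed A \<Longrightarrow> \<bar>f x\<bar> \<le> C"
  shows "test_fun A (\<lambda>s. f (snd s))"
  unfolding test_fun_def
proof (intro conjI ballI)
  show "(\<lambda>s. f (snd s)) \<in> borel_measurable (state_measure A)"
    by (rule measurable_continuous_snd_state[OF assms(1)])
  show "\<exists>C. \<forall>s\<in>states A. \<bar>f (snd s)\<bar> \<le> C" using assms(2) by (auto simp: states_eq)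
  show "continuous_on {x. (\<alpha>, x) \<in> states A} (\<lambda>x. f (snd (\<alpha>, x)))" for \<alpha>
    using continuous_on_subset[OF assms(1)] by simp
qed

abbreviation pure :: "('i \<Rightarrow> 'a) \<Rightarrow> 'i \<Rightarrow> 'a \<Rightarrow> real" where
  "pure \<alpha> \<equiv> \<lambda>i. unitv (\<alpha> i)"

context learning_automata
begin

text \<open>Invariance is defined through sets. It says that \<open>\<mu>\<close> and the law one
  step later agree on all measurable sets, so the two measures are equal and integrate functions
  alike.\<close>

lemma invariant_pm_integral:
  assumes inv: "invariant_pm A u \<epsilon> lam \<mu>" and lam: "0 \<le> lam" "lam \<le> 1"
    and f: "f \<in> borel_measurable (state_measure A)" "\<And>s. s \<in> states A \<Longrightarrow> 0 \<le> f s \<and> f s \<le> 1"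
  shows "(\<integral>s. f s \<partial>\<mu>) = (\<integral>s. (\<Sum>\<alpha> \<in> profiles A. sel_prob A lam s \<alpha> * f (next_state u \<epsilon> s \<alpha>)) \<partial>\<mu>)"
proof -
  have \<mu>: "prob_space \<mu>" "sets \<mu> = sets (state_measure A)" using inv by (auto simp: invariant_pm_def)
  then have sp: "space \<mu> = states A" using sets_eq_imp_space_eq[OF \<mu>(2)] by simp
  have fin: "finite (profiles A)" by simp
  have sel: "0 \<le> sel_prob A lam s \<alpha>" "(\<Sum>\<alpha>\<in>profiles A. sel_prob A lam s \<alpha>) = 1" if "s \<in> space \<mu>" for s \<alpha>
    using that sel_prob_nonneg[OF _ lam] sum_sel_prob by (auto simp: sp states_eq)
  have m: "g \<in> \<mu> \<rightarrow>\<^sub>M M \<longleftrightarrow> g \<in> state_measure A \<rightarrow>\<^sub>M M" for g :: "_ \<Rightarrow> 'm" and M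
    using measurable_cong_sets[OF \<mu>(2) refl] by blast
  obtain \<nu> where \<nu>: "prob_space \<nu>" "sets \<nu> = sets (state_measure A)"
    and \<nu>_int: "\<And>f :: _ \<Rightarrow> real. f \<in> borel_measurable (state_measure A) \<Longrightarrow>
      (\<And>x. x \<in> space (state_measure A) \<Longrightarrow> 0 \<le> f x \<and> f x \<le> 1) \<Longrightarrow>
      (\<integral>x. f x \<partial>\<nu>) = (\<integral>s. (\<Sum>\<alpha>\<in>profiles A. sel_prob A lam s \<alpha> * f (next_state u \<epsilon> s \<alpha>)) \<partial>\<mu>)"
    by (rule one_step_law[where q="\<lambda>\<alpha> s. sel_prob A lam s \<alpha>" and T="\<lambda>\<alpha> s. next_state u \<epsilon> s \<alpha>",
          OF \<mu>(1) fin, unfolded m, OF sel_prob_measurable next_state_measurable sel], assumption+)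
      (rule that; blast)
  have "measure \<mu> B = measure \<nu> B" if B: "B \<in> sets (state_measure A)" for B
  proof -
    have ind: "indicator B \<in> borel_measurable (state_measure A)" using B by simp
    have "measure \<nu> B = (\<integral>x. indicator B x \<partial>\<nu>)"
      using sets.sets_into_space[of B \<nu>] B \<nu> by (simp add: Int_absorb2)
    also have "\<dots> = measure \<mu> B"
      using \<nu>_int[OF ind] inv B by (simp add: invariant_pm_def)
    finally show ?thesis by simp
  qed
  then have "\<mu> = \<nu>"
    using \<mu> \<nu> by (intro measure_eqI)
      (auto simp: finite_measure.emeasure_eq_measure[OF prob_space.finite_measure])
  then show ?thesis using \<nu>_int[OF f(1)] f(2) by simp
qed

text \<open>The product is the selection probability at perturbation 0, so \<open>F\<close> is a
  submartingale along the unperturbed chain. Continuity on the whole function space is what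
  \<open>test_fun_snd\<close> asks for.\<close>

definition subharmonic :: "(('i \<Rightarrow> 'a \<Rightarrow> real) \<Rightarrow> real) \<Rightarrow> bool" where
  "subharmonic F \<longleftrightarrow> continuous_on UNIV F \<and> (\<forall>x\<in>mixed A. 0 \<le> F x \<and> F x \<le> 1) \<and>
     (\<forall>x\<in>mixed A. F x \<le> (\<Sum>\<alpha>\<in>profiles A. (\<Prod>i\<in>UNIV. x i (\<alpha> i)) * F (update u \<epsilon> \<alpha> x)))"

text \<open>Expand the invariance of the perturbed law to first order in the perturbation: for a
  subharmonic function only the terms with exactly one tremble remain.\<close>

lemma limit_weights_single_tremble:
  assumes w: "limit_weights A u \<epsilon> w" and F: "subharmonic F"
  shows "(\<Sum>\<alpha>\<in>profiles A. w \<alpha> * (\<Sum>i\<in>UNIV. (\<Sum>a\<in>A i. F (update u \<epsilon> (\<alpha>(i := a)) (pure \<alpha>))) / real (card (A i))))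
    \<le> real CARD('i) * (\<Sum>\<alpha>\<in>profiles A. w \<alpha> * F (pure \<alpha>))"
proof -
  have Fc: "continuous_on UNIV F" and F01: "\<And>x. x \<in> mixed A \<Longrightarrow> 0 \<le> F x \<and> F x \<le> 1"
    and Fsub: "\<And>x. x \<in> mixed A \<Longrightarrow> F x \<le> (\<Sum>\<alpha>\<in>profiles A. (\<Prod>i\<in>UNIV. x i (\<alpha> i)) * F (update u \<epsilon> \<alpha> x))"
    using F by (auto simp: subharmonic_def)
  let ?n = "CARD('i)"
  \<comment> \<open>The first-order coefficient: one player \<open>i\<close> acts uniformly, the
    others follow their strategies.\<close>
  define G where "G x = (\<Sum>\<alpha>\<in>profiles A. (\<Sum>i\<in>UNIV. (\<Prod>j\<in>UNIV - {i}. x j (\<alpha> j)) / real (card (A i)))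
    * F (update u \<epsilon> \<alpha> x))" for x
  have upd: "update u \<epsilon> \<alpha> x \<in> mixed A" if "x \<in> mixed A" "\<alpha> \<in> profiles A" for x \<alpha>
    using update_mixed that by auto
  have Fupd: "continuous_on UNIV (\<lambda>x. F (update u \<epsilon> \<alpha> x))" for \<alpha>
    by (rule continuous_on_compose2[OF Fc continuous_update[OF continuous_on_id]]) auto
  have Gc: "continuous_on UNIV G"
    unfolding G_def using nonempty
    by (intro continuous_on_sum continuous_on_mult continuous_on_divide continuous_on_prod continuous_on_const
        Fupd continuous_coordinate[OF continuous_on_id]) auto
  have x01: "0 \<le> x i b" "x i b \<le> 1" if "x \<in> mixed A" for x i b
    using that mixed_le_1[of x A] by (auto simp: mixed_def)
  define C where "C = (\<Sum>\<alpha>\<in>profiles A. (\<Sum>i\<in>(UNIV::'i set). 1 / real (card (A i))) * 1)"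
  have G0: "0 \<le> G x" "G x \<le> C" if x: "x \<in> mixed A" for x
  proof -
    show "0 \<le> G x" unfolding G_def using F01[OF upd[OF x]] x01[OF x]
      by (intro sum_nonneg mult_nonneg_nonneg divide_nonneg_nonneg prod_nonneg) auto
    show "G x \<le> C" unfolding G_def C_def using F01[OF upd[OF x]] x01[OF x]
      by (intro sum_mono mult_mono divide_right_mono prod_le_1 sum_nonneg) auto
  qed
  \<comment> \<open>A choice of invariant laws, justified by \<open>invariant_pm_exists\<close>;
    \<open>limit_weights\<close> describes the limit of every such choice.\<close>
  define \<mu> where "\<mu> lam = (SOME \<mu>. invariant_pm A u \<epsilon> lam \<mu>)" for lam
  have inv: "invariant_pm A u \<epsilon> lam (\<mu> lam)" if "lam \<in> {0<..<1}" for lam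
    unfolding \<mu>_def using invariant_pm_exists[of lam] that by (auto intro: someI_ex)
  have conv: "((\<lambda>lam. \<integral>s. f (snd s) \<partial>\<mu> lam) \<longlongrightarrow> (\<Sum>\<alpha>\<in>profiles A. w \<alpha> * f (pure \<alpha>))) (at_right 0)"
    if "continuous_on UNIV f" "\<And>x. x \<in> mixed A \<Longrightarrow> \<bar>f x\<bar> \<le> c" for f c
  proof -
    have "weak_conv_pure A \<mu> w" using w inv by (simp add: limit_weights_def)
    then show ?thesis using test_fun_snd[OF that] unfolding weak_conv_pure_def pure_state_def by fastforce
  qed
  have limF: "((\<lambda>lam. real ?n * (\<integral>s. F (snd s) \<partial>\<mu> lam)) \<longlongrightarrow> real ?n * (\<Sum>\<alpha>\<in>profiles A. w \<alpha> * F (pure \<alpha>))) (at_right 0)"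
    using F01 by (intro tendsto_intros conv[OF Fc, of 1]) auto
  have "((\<lambda>lam. (1 - lam) ^ (?n - 1) * (\<integral>s. G (snd s) \<partial>\<mu> lam)) \<longlongrightarrow> (1 - 0) ^ (?n - 1) * (\<Sum>\<alpha>\<in>profiles A. w \<alpha> * G (pure \<alpha>))) (at_right 0)"
    using G0 by (intro tendsto_intros conv[OF Gc, of C]) auto
  then have limG: "((\<lambda>lam. (1 - lam) ^ (?n - 1) * (\<integral>s. G (snd s) \<partial>\<mu> lam)) \<longlongrightarrow> (\<Sum>\<alpha>\<in>profiles A. w \<alpha> * G (pure \<alpha>))) (at_right 0)"
    by simp
  \<comment> \<open>Without trembles, subharmonicity and the Bernoulli inequality give the first
    term; one tremble gives the second; outcomes with several trembles are dropped as
    nonnegative.\<close>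
  have pert: "(1 - real ?n * lam) * F x + lam * (1 - lam) ^ (?n - 1) * G x
      \<le> (\<Sum>\<alpha>\<in>profiles A. sel_prob A lam (\<beta>, x) \<alpha> * F (update u \<epsilon> \<alpha> x))"
    if lam: "0 < lam" "lam < 1" and x: "x \<in> mixed A" for lam x \<beta>
  proof -
    have "(1 - real ?n * lam) * F x \<le> (1 - lam) ^ ?n * F x"
      using Bernoulli_inequality[of "-lam" ?n] lam F01[OF x] by (intro mult_right_mono) auto
    also have "\<dots> \<le> (1 - lam) ^ ?n * (\<Sum>\<alpha>\<in>profiles A. (\<Prod>i\<in>UNIV. x i (\<alpha> i)) * F (update u \<epsilon> \<alpha> x))"
      using Fsub[OF x] lam by (intro mult_left_mono) auto
    finally have "(1 - real ?n * lam) * F x + lam * (1 - lam) ^ (?n - 1) * G x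
      \<le> (\<Sum>\<alpha>\<in>profiles A. ((1 - lam) ^ ?n * (\<Prod>i\<in>UNIV. x i (\<alpha> i))
        + lam * (1 - lam) ^ (?n - 1) * (\<Sum>i\<in>UNIV. (\<Prod>j\<in>UNIV - {i}. x j (\<alpha> j)) / real (card (A i)))) * F (update u \<epsilon> \<alpha> x))"
      by (simp add: G_def sum_distrib_left sum.distrib algebra_simps)
    also have "\<dots> \<le> (\<Sum>\<alpha>\<in>profiles A. sel_prob A lam (\<beta>, x) \<alpha> * F (update u \<epsilon> \<alpha> x))"
    proof (intro sum_mono mult_right_mono)
      fix \<alpha> assume \<alpha>: "\<alpha> \<in> profiles A"
      show "0 \<le> F (update u \<epsilon> \<alpha> x)" using F01[OF upd[OF x \<alpha>]] by auto
      have "(\<Prod>i\<in>UNIV. (1 - lam) * x i (\<alpha> i)) = (1 - lam) ^ ?n * (\<Prod>i\<in>UNIV. x i (\<alpha> i))"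
        by (simp add: prod.distrib)
      moreover have "(\<Sum>i\<in>UNIV. lam / real (card (A i)) * (\<Prod>j\<in>UNIV - {i}. (1 - lam) * x j (\<alpha> j)))
        = lam * (1 - lam) ^ (?n - 1) * (\<Sum>i\<in>UNIV. (\<Prod>j\<in>UNIV - {i}. x j (\<alpha> j)) / real (card (A i)))"
        by (simp add: prod.distrib sum_distrib_left card_Diff_singleton ac_simps)
      moreover have "(\<Prod>i\<in>UNIV. (1 - lam) * x i (\<alpha> i)) + (\<Sum>i\<in>UNIV. lam / real (card (A i)) * (\<Prod>j\<in>UNIV - {i}. (1 - lam) * x j (\<alpha> j)))
        \<le> (\<Prod>i\<in>UNIV. (1 - lam) * x i (\<alpha> i) + lam / real (card (A i)))"
        using lam x01[OF x] by (intro prod_add_ge_linear_part) auto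
      ultimately show "(1 - lam) ^ ?n * (\<Prod>i\<in>UNIV. x i (\<alpha> i))
        + lam * (1 - lam) ^ (?n - 1) * (\<Sum>i\<in>UNIV. (\<Prod>j\<in>UNIV - {i}. x j (\<alpha> j)) / real (card (A i)))
        \<le> sel_prob A lam (\<beta>, x) \<alpha>"
        by (simp add: sel_prob_def)
    qed
    finally show ?thesis .
  qed
  \<comment> \<open>Integrating \<open>pert\<close> against the invariant law turns its right side
    into the integral of \<open>F\<close>, which cancels; dividing by \<open>lam\<close> leaves the
    first-order terms.\<close>
  have int: "(1 - lam) ^ (?n - 1) * (\<integral>s. G (snd s) \<partial>\<mu> lam) \<le> real ?n * (\<integral>s. F (snd s) \<partial>\<mu> lam)"
    if lam: "0 < lam" "lam < 1" for lam
  proof -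
    have i: "invariant_pm A u \<epsilon> lam (\<mu> lam)" using inv lam by auto
    then interpret M: prob_space "\<mu> lam" by (simp add: invariant_pm_def)
    have sets: "sets (\<mu> lam) = sets (state_measure A)" using i by (simp add: invariant_pm_def)
    then have sp: "space (\<mu> lam) = states A" using sets_eq_imp_space_eq[OF sets] by simp
    have integ: "integrable (\<mu> lam) (\<lambda>s. f (snd s))"
      if "continuous_on UNIV f" "\<And>x. x \<in> mixed A \<Longrightarrow> \<bar>f x\<bar> \<le> c" for f and c :: real
      using that measurable_continuous_snd_state[OF that(1), of A]
      by (intro M.integrable_const_bound[where B=c])
        (auto simp: measurable_cong_sets[OF sets refl] sp states_eq intro!: AE_I2)
    have iF: "integrable (\<mu> lam) (\<lambda>s. F (snd s))" using integ[OF Fc, of 1] F01 by auto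
    have iG: "integrable (\<mu> lam) (\<lambda>s. G (snd s))" using integ[OF Gc, of C] G0 by auto
    \<comment> \<open>\<open>undefined\<close> fills the profile slot, which \<open>sel_prob\<close>
      ignores.\<close>
    let ?P = "\<lambda>x. \<Sum>\<alpha>\<in>profiles A. sel_prob A lam (undefined, x) \<alpha> * F (update u \<epsilon> \<alpha> x)"
    have P: "\<bar>?P x\<bar> \<le> 1" if x: "x \<in> mixed A" for x
    proof -
      have "0 \<le> ?P x" using sel_prob_nonneg[OF x] F01[OF upd[OF x]] lam by (intro sum_nonneg) auto
      moreover have "?P x \<le> (\<Sum>\<alpha>\<in>profiles A. sel_prob A lam (undefined, x) \<alpha> * 1)"
        using sel_prob_nonneg[OF x] F01[OF upd[OF x]] lam by (intro sum_mono mult_left_mono) auto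
      ultimately show ?thesis using sum_sel_prob[OF x] by simp
    qed
    have Pc: "continuous_on UNIV ?P"
      by (intro continuous_on_sum continuous_on_mult continuous_sel_prob[OF continuous_on_id] Fupd)
    have "(1 - real ?n * lam) * (\<integral>s. F (snd s) \<partial>\<mu> lam) + lam * (1 - lam) ^ (?n - 1) * (\<integral>s. G (snd s) \<partial>\<mu> lam)
      = (\<integral>s. (1 - real ?n * lam) * F (snd s) + lam * (1 - lam) ^ (?n - 1) * G (snd s) \<partial>\<mu> lam)"
      using iF iG by simp
    also have "\<dots> \<le> (\<integral>s. ?P (snd s) \<partial>\<mu> lam)"
      using iF iG integ[OF Pc P] pert[OF lam]
      by (intro integral_mono) (auto simp: sp states_eq)
    also have "\<dots> = (\<integral>s. F (snd s) \<partial>\<mu> lam)"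
    proof -
      have "0 \<le> F (snd s) \<and> F (snd s) \<le> 1" if "s \<in> states A" for s
        using that F01 by (auto simp: states_eq)
      from invariant_pm_integral[OF i _ _ measurable_continuous_snd_state[OF Fc] this] lam show ?thesis
        by (simp add: next_state_eq sel_prob_def)
    qed
    finally have "lam * ((1 - lam) ^ (?n - 1) * (\<integral>s. G (snd s) \<partial>\<mu> lam)) \<le> lam * (real ?n * (\<integral>s. F (snd s) \<partial>\<mu> lam))"
      by (simp add: algebra_simps)
    then show ?thesis using lam by simp
  qed
  have "(\<Sum>\<alpha>\<in>profiles A. w \<alpha> * G (pure \<alpha>)) \<le> real ?n * (\<Sum>\<alpha>\<in>profiles A. w \<alpha> * F (pure \<alpha>))"
  proof (rule tendsto_le[OF _ limF limG])
    show "\<forall>\<^sub>F lam in at_right 0. (1 - lam) ^ (?n - 1) * (\<integral>s. G (snd s) \<partial>\<mu> lam) \<le> real ?n * (\<integral>s. F (snd s) \<partial>\<mu> lam)"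
      using int by (auto simp: eventually_at_right_field intro!: exI[of _ 1])
  qed simp
  \<comment> \<open>At a pure state the product over the other players is 1 on the profiles
    \<open>\<alpha>(i := a)\<close>; all remaining profiles contribute nonnegative terms.\<close>
  moreover have "(\<Sum>i\<in>UNIV. (\<Sum>a\<in>A i. F (update u \<epsilon> (\<alpha>(i := a)) (pure \<alpha>))) / real (card (A i))) \<le> G (pure \<alpha>)"
    if \<alpha>: "\<alpha> \<in> profiles A" for \<alpha>
  proof -
    have "G (pure \<alpha>) = (\<Sum>i\<in>UNIV. (\<Sum>\<alpha>'\<in>profiles A. (\<Prod>j\<in>UNIV - {i}. unitv (\<alpha> j) (\<alpha>' j)) * F (update u \<epsilon> \<alpha>' (pure \<alpha>))) / real (card (A i)))"
      unfolding G_def by (simp add: sum_distrib_right sum_divide_distrib) (rule sum.swap)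
    also have "\<dots> \<ge> (\<Sum>i\<in>UNIV. (\<Sum>a\<in>A i. F (update u \<epsilon> (\<alpha>(i := a)) (pure \<alpha>))) / real (card (A i)))"
    proof (intro sum_mono divide_right_mono)
      fix i
      have inj: "inj_on (\<lambda>a. \<alpha>(i := a)) (A i)" by (auto simp: inj_on_def dest: fun_cong[of _ _ i])
      have "(\<Sum>a\<in>A i. F (update u \<epsilon> (\<alpha>(i := a)) (pure \<alpha>)))
        = (\<Sum>\<alpha>'\<in>(\<lambda>a. \<alpha>(i := a)) ` A i. (\<Prod>j\<in>UNIV - {i}. unitv (\<alpha> j) (\<alpha>' j)) * F (update u \<epsilon> \<alpha>' (pure \<alpha>)))"
        unfolding sum.reindex[OF inj] by (simp add: unitv_def)
      also have "\<dots> \<le> (\<Sum>\<alpha>'\<in>profiles A. (\<Prod>j\<in>UNIV - {i}. unitv (\<alpha> j) (\<alpha>' j)) * F (update u \<epsilon> \<alpha>' (pure \<alpha>)))"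
        using \<alpha> F01[OF upd[OF pure_mixed[OF \<alpha>]]]
        by (intro sum_mono2 mult_nonneg_nonneg prod_nonneg) (auto simp: profiles_def unitv_def)
      finally show "(\<Sum>a\<in>A i. F (update u \<epsilon> (\<alpha>(i := a)) (pure \<alpha>)))
        \<le> (\<Sum>\<alpha>'\<in>profiles A. (\<Prod>j\<in>UNIV - {i}. unitv (\<alpha> j) (\<alpha>' j)) * F (update u \<epsilon> \<alpha>' (pure \<alpha>)))" .
    qed auto
    finally show ?thesis .
  qed
  then have "(\<Sum>\<alpha>\<in>profiles A. w \<alpha> * (\<Sum>i\<in>UNIV. (\<Sum>a\<in>A i. F (update u \<epsilon> (\<alpha>(i := a)) (pure \<alpha>))) / real (card (A i))))
    \<le> (\<Sum>\<alpha>\<in>profiles A. w \<alpha> * G (pure \<alpha>))"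
    using w by (intro sum_mono mult_left_mono) (auto simp: limit_weights_def)
  ultimately show ?thesis by linarith
qed

end

section \<open>Submartingales concentrated on edges\<close>

text \<open>With \<open>t = (1 - s) / s\<close>, division by \<open>s ^ (M + 1)\<close> leaves
  \<open>1 + t \<le> (1 + \<delta> * t) ^ M\<close>, which is the Bernoulli inequality. The gain in
  the power thus pays for the probability \<open>s\<close> of staying on the edge once more.\<close>

lemma power_dominates_after_shift:
  fixes s \<delta> :: real
  assumes s: "0 \<le> s" "s \<le> 1" and \<delta>: "0 \<le> \<delta>" and M: "1 \<le> real M * \<delta>"
  shows "s ^ M \<le> s * (s + \<delta> * (1 - s)) ^ M"
proof (cases "s = 0")
  case True
  have "M \<noteq> 0" using M by (cases M) auto
  then show ?thesis using True by (simp add: zero_power)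
next
  case False
  define t where "t = (1 - s) / s"
  have t: "0 \<le> t" "s * (1 + t) = 1" "s * (1 + \<delta> * t) = s + \<delta> * (1 - s)"
    using s False by (auto simp: t_def field_simps)
  have "1 * t \<le> (real M * \<delta>) * t" using M t(1) by (rule mult_right_mono)
  also have "1 + (real M * \<delta>) * t \<le> (1 + \<delta> * t) ^ M"
    using Bernoulli_inequality[OF order_trans[OF _ mult_nonneg_nonneg[OF \<delta> t(1)]], of M] by (simp add: mult.assoc)
  finally have "1 + t \<le> (1 + \<delta> * t) ^ M" by simp
  then have "s ^ M * (s * (1 + t)) \<le> s ^ M * (s * (1 + \<delta> * t) ^ M)"
    using s by (intro mult_left_mono) auto
  then show ?thesis using t by (simp flip: t(3) add: power_mult_distrib mult.left_commute)
qed

text \<open>Expand both exponentials to second order. The first-order terms add up to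
  \<open>- \<rho> * y * (1 - y) * (U - v)\<close>, and the last assumption lets them absorb the
  quadratic ones; \<open>\<rho> * v \<le> 1\<close> keeps the growing exponential in the range of
  \<open>exp_bound\<close>.\<close>

lemma exp_two_point_le_1:
  fixes U v \<rho> y :: real
  assumes "0 \<le> y" "y \<le> 1" "0 \<le> U" "0 \<le> v" "0 \<le> \<rho>" "\<rho> * v \<le> 1" "\<rho> * (U\<^sup>2 + v\<^sup>2) \<le> U - v"
  shows "y * exp (- (\<rho> * U * (1 - y))) + (1 - y) * exp (\<rho> * v * y) \<le> 1"
proof -
  have e1: "exp (- t) \<le> 1 - t + t\<^sup>2" if "0 \<le> t" for t :: real
  proof -
    have "exp (- t) \<le> 1 / (1 + t)" using exp_ge_add_one_self[of t] that by (simp add: exp_minus field_simps)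
    also have "\<dots> \<le> 1 - t + t\<^sup>2"
    proof -
      have "1 \<le> (1 - t + t\<^sup>2) * (1 + t)" using that by (simp add: algebra_simps power2_eq_square)
      then show ?thesis using that by (simp add: pos_divide_le_eq)
    qed
    finally show ?thesis .
  qed
  have "\<rho> * v * y \<le> 1 * 1" using assms by (intro mult_mono) auto
  then have e2: "exp (\<rho> * v * y) \<le> 1 + \<rho> * v * y + (\<rho> * v * y)\<^sup>2"
    using assms by (intro exp_bound) auto
  have "y * exp (- (\<rho> * U * (1 - y))) + (1 - y) * exp (\<rho> * v * y)
    \<le> y * (1 - \<rho> * U * (1 - y) + (\<rho> * U * (1 - y))\<^sup>2) + (1 - y) * (1 + \<rho> * v * y + (\<rho> * v * y)\<^sup>2)"
    using assms e2 by (intro add_mono mult_left_mono e1) auto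
  also have "\<dots> = 1 - \<rho> * (y * (1 - y)) * ((U - v) - \<rho> * (U\<^sup>2 * (1 - y) + v\<^sup>2 * y))"
    by (simp add: algebra_simps power2_eq_square)
  also have "\<dots> \<le> 1"
  proof -
    have "U\<^sup>2 * (1 - y) \<le> U\<^sup>2" "v\<^sup>2 * y \<le> v\<^sup>2" using assms by (auto simp: mult_left_le)
    then have "\<rho> * (U\<^sup>2 * (1 - y) + v\<^sup>2 * y) \<le> \<rho> * (U\<^sup>2 + v\<^sup>2)"
      using assms by (intro mult_left_mono) auto
    then have "0 \<le> (U - v) - \<rho> * (U\<^sup>2 * (1 - y) + v\<^sup>2 * y)" using assms by linarith
    then show ?thesis using assms by simp
  qed
  finally show ?thesis .
qed

section \<open>Construction of the submartingales\<close>

context learning_automata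
begin

lemma subharmonic_max:
  assumes F: "subharmonic F" and G: "subharmonic G"
  shows "subharmonic (\<lambda>x. max (F x) (G x))"
  unfolding subharmonic_def
proof (intro conjI ballI)
  show "continuous_on UNIV (\<lambda>x. max (F x) (G x))"
    using F G by (intro continuous_on_max) (auto simp: subharmonic_def)
  fix x assume x: "x \<in> mixed A"
  show "0 \<le> max (F x) (G x)" "max (F x) (G x) \<le> 1" using F G x by (auto simp: subharmonic_def le_max_iff_disj)
  let ?P = "\<lambda>H. \<Sum>\<alpha>\<in>profiles A. (\<Prod>i\<in>UNIV. x i (\<alpha> i)) * H (update u \<epsilon> \<alpha> x)"
  have mono: "?P H \<le> ?P (\<lambda>x. max (F x) (G x))" if "\<And>x. H x \<le> max (F x) (G x)" for H
    using x that by (intro sum_mono mult_left_mono prod_nonneg) (auto simp: mixed_def)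
  have "F x \<le> ?P F" "G x \<le> ?P G" using F G x by (auto simp: subharmonic_def)
  then show "max (F x) (G x) \<le> ?P (\<lambda>x. max (F x) (G x))"
    using mono[of F] mono[of G] by linarith
qed

text \<open>Iterates \<open>subharmonic_max\<close> from the constant 0, which is why
  \<open>v\<close> has to be nonnegative.\<close>

lemma subharmonic_finite_upper_bound:
  assumes "finite K" "\<And>H. H \<in> K \<Longrightarrow> subharmonic H"
    and "\<And>H \<alpha>. H \<in> K \<Longrightarrow> \<alpha> \<in> profiles A \<Longrightarrow> H (pure \<alpha>) \<le> v \<alpha>" "\<And>\<alpha>. 0 \<le> v \<alpha>"
  obtains F where "subharmonic F" "\<And>H x. H \<in> K \<Longrightarrow> H x \<le> F x" "\<And>\<alpha>. \<alpha> \<in> profiles A \<Longrightarrow> F (pure \<alpha>) \<le> v \<alpha>"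
proof -
  have "\<exists>F. subharmonic F \<and> (\<forall>H\<in>K. \<forall>x. H x \<le> F x) \<and> (\<forall>\<alpha>\<in>profiles A. F (pure \<alpha>) \<le> v \<alpha>)"
    using assms
  proof (induction K rule: finite_induct)
    case empty
    have "subharmonic (\<lambda>_. 0)" by (simp add: subharmonic_def)
    then show ?case using empty by blast
  next
    case (insert H K)
    then obtain F where F: "subharmonic F" "\<forall>H\<in>K. \<forall>x. H x \<le> F x" "\<forall>\<alpha>\<in>profiles A. F (pure \<alpha>) \<le> v \<alpha>"
      by (metis insertCI)
    show ?case
    proof (intro exI conjI)
      show "subharmonic (\<lambda>x. max (F x) (H x))" using F insert by (intro subharmonic_max) auto
    qed (use F insert in \<open>auto simp: le_max_iff_disj\<close>)
  qed
  then show ?thesis using that by blast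
qed

text \<open>The factor is the probability that play stays on the edge from \<open>\<alpha>\<close> to \<open>\<alpha>(i := a)\<close>, raised to
  a power large enough to be a submartingale with room to spare, while \<open>\<gamma>\<close> only has to be
  a submartingale for the two-action process on the edge.\<close>

lemma edge_subharmonic:
  fixes \<gamma> :: "real \<Rightarrow> real"
  assumes \<alpha>: "\<alpha> \<in> profiles A" and a: "a \<in> A i" "a \<noteq> \<alpha> i"
    and \<gamma>_cont: "continuous_on UNIV \<gamma>"
    and \<gamma>_bounds: "\<And>y. 0 \<le> y \<Longrightarrow> y \<le> 1 \<Longrightarrow> 0 \<le> \<gamma> y \<and> \<gamma> y \<le> 1"
    and \<gamma>_mono: "\<And>y z. 0 \<le> y \<Longrightarrow> y \<le> z \<Longrightarrow> z \<le> 1 \<Longrightarrow> \<gamma> y \<le> \<gamma> z"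
    and \<gamma>_sub: "\<And>y. 0 \<le> y \<Longrightarrow> y \<le> 1 \<Longrightarrow>
      \<gamma> y \<le> y * \<gamma> (y + \<epsilon> * u i (\<alpha>(i := a)) * (1 - y)) + (1 - y) * \<gamma> (y - \<epsilon> * u i \<alpha> * y)"
    and \<gamma>_0: "\<gamma> 0 = 0"
  obtains H where "subharmonic H"
    "H (update u \<epsilon> (\<alpha>(i := a)) (pure \<alpha>)) = \<gamma> (\<epsilon> * u i (\<alpha>(i := a)))"
    "H (update u \<epsilon> \<alpha> (pure (\<alpha>(i := a)))) = \<gamma> (1 - \<epsilon> * u i \<alpha>)"
    "H (pure (\<alpha>(i := a))) = \<gamma> 1"
    "\<And>\<alpha>'. \<alpha>' \<noteq> \<alpha>(i := a) \<Longrightarrow> H (pure \<alpha>') = 0"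
proof -
  obtain \<delta> where \<delta>: "0 < \<delta>" "\<delta> < 1" "\<And>i \<alpha>. \<alpha> \<in> profiles A \<Longrightarrow> \<delta> \<le> \<epsilon> * u i \<alpha>"
    using uniform_rate by blast
  obtain M where M: "1 \<le> real M * \<delta>"
    using reals_Archimedean3[OF \<delta>(1)] by (meson less_imp_le)
  then have "M \<noteq> 0" by (cases M) auto
  define \<beta> where "\<beta> = \<alpha>(i := a)"
  have \<beta>: "\<beta> \<in> profiles A" using \<alpha> a by (auto simp: \<beta>_def profiles_def)
  have \<alpha>A: "\<alpha> j \<in> A j" for j using \<alpha> by (auto simp: profiles_def)
  \<comment> \<open>The probability that player \<open>j\<close> picks an action used on the edge;
    player \<open>i\<close> has two of these.\<close>
  define m where "m x j = (if j = i then x i (\<alpha> i) + x i a else x j (\<alpha> j))" for x :: "'i \<Rightarrow> 'a \<Rightarrow> real" and j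
  define H where "H x = (\<Prod>j\<in>UNIV. m x j) ^ M * \<gamma> (x i a)" for x
  have x01: "0 \<le> x j b" "x j b \<le> 1" if "x \<in> mixed A" for x j b
    using that mixed_le_1[of x A] by (auto simp: mixed_def)
  have m01: "0 \<le> m x j" "m x j \<le> 1" if x: "x \<in> mixed A" for x j
  proof -
    show "0 \<le> m x j" using x01[OF x] by (simp add: m_def)
    have "x i (\<alpha> i) + x i a = sum (x i) {\<alpha> i, a}" using a by simp
    also have "\<dots> \<le> sum (x i) (A i)" using a \<alpha>A x01[OF x] by (intro sum_mono2) auto
    finally show "m x j \<le> 1" using x x01[OF x] by (simp add: m_def mixed_def)
  qed
  \<comment> \<open>Both end profiles of the edge pull \<open>m x j\<close> towards 1, at rate at
    least \<open>\<delta>\<close>.\<close>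
  have m_upd: "m (update u \<epsilon> \<alpha>' x) j = m x j + \<epsilon> * u j \<alpha>' * (1 - m x j)" if "\<alpha>' = \<alpha> \<or> \<alpha>' = \<beta>" for \<alpha>' x j
    using that a by (auto simp: m_def update_def \<beta>_def unitv_def algebra_simps)
  have H01: "0 \<le> H x \<and> H x \<le> 1" if x: "x \<in> mixed A" for x
    unfolding H_def using m01[OF x] \<gamma>_bounds[of "x i a"] x01[OF x]
    by (auto intro!: mult_nonneg_nonneg mult_le_one zero_le_power power_le_one prod_nonneg prod_le_1)
  have H_sub: "subharmonic H"
    unfolding subharmonic_def
  proof (intro conjI ballI)
    have "continuous_on UNIV (\<lambda>x. m x j)" for j
      unfolding m_def
      by (cases "j = i") (auto intro!: continuous_on_add continuous_coordinate[OF continuous_on_id])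
    then show "continuous_on UNIV H"
      unfolding H_def
      by (intro continuous_on_mult continuous_on_power continuous_on_prod
          continuous_on_compose2[OF \<gamma>_cont continuous_coordinate[OF continuous_on_id]]) auto
    fix x assume x: "x \<in> mixed A"
    show "0 \<le> H x" "H x \<le> 1" using H01[OF x] by auto
    \<comment> \<open>A common lower bound for \<open>m x j\<close> after a step on the
      edge.\<close>
    define t where "t j = m x j + \<delta> * (1 - m x j)" for j
    define y where "y = x i a"
    define s where "s = m x i"
    define R where "R = (\<Prod>j\<in>UNIV - {i}. x j (\<alpha> j))"
    have y: "0 \<le> y" "y \<le> s" "s \<le> 1" "x i (\<alpha> i) = s - y" "y \<le> 1"
      using x01[OF x] m01[OF x, of i] by (auto simp: y_def s_def m_def)
    have R0: "0 \<le> R" unfolding R_def using x01[OF x] by (intro prod_nonneg) auto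
    have t0: "0 \<le> t j" for j unfolding t_def using m01[OF x, of j] \<delta> by simp
    have t_le: "(\<Prod>j\<in>UNIV. t j) ^ M \<le> (\<Prod>j\<in>UNIV. m (update u \<epsilon> \<alpha>' x) j) ^ M" if "\<alpha>' = \<alpha> \<or> \<alpha>' = \<beta>" for \<alpha>'
    proof (intro power_mono prod_mono conjI prod_nonneg ballI t0)
      fix j
      have "\<alpha>' \<in> profiles A" using that \<alpha> \<beta> by auto
      then show "t j \<le> m (update u \<epsilon> \<alpha>' x) j"
        unfolding t_def m_upd[OF that] using m01[OF x, of j] \<delta>(3)[of \<alpha>' j] by (intro add_left_mono mult_right_mono) auto
    qed
    let ?up = "y + \<epsilon> * u i \<beta> * (1 - y)" and ?down = "y - \<epsilon> * u i \<alpha> * y"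
    have up: "0 \<le> ?up" "?up \<le> 1" and down: "0 \<le> ?down" "?down \<le> y"
    proof -
      have "0 \<le> \<epsilon> * u i \<beta> * (1 - y)"
        using rate[OF \<beta>, of i] y by simp
      moreover have "\<epsilon> * u i \<beta> * (1 - y) \<le> 1 * (1 - y)"
        using rate[OF \<beta>, of i] y by (intro mult_right_mono) auto
      ultimately show "0 \<le> ?up" "?up \<le> 1" using y by auto
      have "0 \<le> \<epsilon> * u i \<alpha> * y"
        using rate[OF \<alpha>, of i] y by simp
      moreover have "\<epsilon> * u i \<alpha> * y \<le> 1 * y"
        using rate[OF \<alpha>, of i] y by (intro mult_right_mono) auto
      ultimately show "0 \<le> ?down" "?down \<le> y" by auto
    qed
    \<comment> \<open>Player \<open>i\<close> may leave the edge with probability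
      \<open>1 - s\<close>. By monotonicity that share of \<open>\<gamma>_sub\<close> is at most
      \<open>(1 - s) * \<gamma> y\<close>, which is subtracted.\<close>
    have \<gamma>s: "s * \<gamma> y \<le> (s - y) * \<gamma> ?down + y * \<gamma> ?up"
    proof -
      have "(1 - s) * \<gamma> ?down \<le> (1 - s) * \<gamma> y"
        using y down by (intro mult_left_mono \<gamma>_mono) auto
      then show ?thesis using \<gamma>_sub[OF y(1,5)] unfolding \<beta>_def[symmetric] by (simp add: algebra_simps)
    qed
    have split: "(\<Prod>j\<in>UNIV. f j) = f i * (\<Prod>j\<in>UNIV - {i}. f j)" for f :: "'i \<Rightarrow> real"
      by (simp add: prod.remove[of UNIV i])
    have p\<alpha>: "(\<Prod>j\<in>UNIV. x j (\<alpha> j)) = (s - y) * R" by (simp add: split R_def y)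
    have p\<beta>: "(\<Prod>j\<in>UNIV. x j (\<beta> j)) = y * R" by (simp add: split R_def y_def \<beta>_def)
    have pm: "(\<Prod>j\<in>UNIV. m x j) = s * R" by (simp add: split R_def s_def m_def)
    have y\<alpha>: "update u \<epsilon> \<alpha> x i a = ?down" using a by (simp add: update_def unitv_def y_def)
    have y\<beta>: "update u \<epsilon> \<beta> x i a = ?up" using a by (simp add: update_def unitv_def y_def \<beta>_def)
    have "H x = (\<Prod>j\<in>UNIV. m x j ^ M) * \<gamma> y" by (simp add: H_def y_def prod_power_distrib)
    \<comment> \<open>Each player contributes one factor \<open>m x j\<close>; together they form
      the probability \<open>s * R\<close> of staying on the edge.\<close>
    also have "\<dots> \<le> (\<Prod>j\<in>UNIV. m x j * t j ^ M) * \<gamma> y"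
      using m01[OF x] \<delta>(1) M \<gamma>_bounds[OF y(1,5)] unfolding t_def
      by (intro mult_right_mono prod_mono conjI power_dominates_after_shift zero_le_power) auto
    also have "\<dots> = (\<Prod>j\<in>UNIV. t j) ^ M * R * (s * \<gamma> y)"
      by (simp add: prod.distrib pm prod_power_distrib)
    also have "\<dots> \<le> (\<Prod>j\<in>UNIV. t j) ^ M * R * ((s - y) * \<gamma> ?down + y * \<gamma> ?up)"
      using \<gamma>s R0 t0 by (intro mult_left_mono mult_nonneg_nonneg zero_le_power prod_nonneg) auto
    also have "\<dots> = (s - y) * R * ((\<Prod>j\<in>UNIV. t j) ^ M * \<gamma> ?down) + y * R * ((\<Prod>j\<in>UNIV. t j) ^ M * \<gamma> ?up)"
      by (simp add: algebra_simps)
    also have "\<dots> \<le> (s - y) * R * H (update u \<epsilon> \<alpha> x) + y * R * H (update u \<epsilon> \<beta> x)"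
    proof (intro add_mono mult_left_mono)
      show "(\<Prod>j\<in>UNIV. t j) ^ M * \<gamma> ?down \<le> H (update u \<epsilon> \<alpha> x)"
        unfolding H_def y\<alpha> using \<gamma>_bounds[of ?down] down y by (intro mult_right_mono t_le) auto
      show "(\<Prod>j\<in>UNIV. t j) ^ M * \<gamma> ?up \<le> H (update u \<epsilon> \<beta> x)"
        unfolding H_def y\<beta> using \<gamma>_bounds[of ?up] up by (intro mult_right_mono t_le) auto
    qed (use y R0 in auto)
    also have "\<dots> = (\<Sum>\<alpha>'\<in>{\<alpha>, \<beta>}. (\<Prod>j\<in>UNIV. x j (\<alpha>' j)) * H (update u \<epsilon> \<alpha>' x))"
    proof -
      have "\<alpha> \<noteq> \<beta>" using a by (metis \<beta>_def fun_upd_same)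
      then show ?thesis by (simp add: p\<alpha> p\<beta>)
    qed
    also have "\<dots> \<le> (\<Sum>\<alpha>'\<in>profiles A. (\<Prod>j\<in>UNIV. x j (\<alpha>' j)) * H (update u \<epsilon> \<alpha>' x))"
      using \<alpha> \<beta> x01[OF x] H01[OF update_mixed[OF x]]
      by (intro sum_mono2 mult_nonneg_nonneg prod_nonneg) auto
    finally show "H x \<le> (\<Sum>\<alpha>'\<in>profiles A. (\<Prod>j\<in>UNIV. x j (\<alpha>' j)) * H (update u \<epsilon> \<alpha>' x))" .
  qed
  have m_pure: "m (pure \<alpha>) j = 1" "m (pure \<beta>) j = 1" for j
    using a by (auto simp: m_def unitv_def \<beta>_def)
  have H_values: "H (update u \<epsilon> \<beta> (pure \<alpha>)) = \<gamma> (\<epsilon> * u i \<beta>)" "H (update u \<epsilon> \<alpha> (pure \<beta>)) = \<gamma> (1 - \<epsilon> * u i \<alpha>)" "H (pure \<beta>) = \<gamma> 1"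
    using a unfolding H_def
    by (simp_all add: m_upd m_pure) (simp_all add: update_def unitv_def \<beta>_def)
  \<comment> \<open>Either player \<open>i\<close> does not play \<open>a\<close>, and
    \<open>\<gamma> 0 = 0\<close> applies, or another player is off the edge and the first factor
    vanishes.\<close>
  have "H (pure \<alpha>') = 0" if ne: "\<alpha>' \<noteq> \<beta>" for \<alpha>'
  proof (cases "\<alpha>' i = a")
    case True
    obtain j where "\<alpha>' j \<noteq> \<beta> j" using ne by (auto simp: fun_eq_iff)
    with True have "j \<noteq> i" "\<alpha>' j \<noteq> \<alpha> j" by (auto simp: \<beta>_def split: if_splits)
    then have "m (pure \<alpha>') j = 0" by (simp add: m_def unitv_def)
    then have "(\<Prod>j\<in>UNIV. m (pure \<alpha>') j) = 0" by (auto simp: prod_zero_iff)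
    then show ?thesis using \<open>M \<noteq> 0\<close> by (simp add: H_def)
  qed (simp add: H_def unitv_def \<gamma>_0)
  then show ?thesis using that[OF H_sub] H_values unfolding \<beta>_def by blast
qed

text \<open>Take \<open>1 - exp (- \<rho> * y / \<epsilon>)\<close> on the edge. A step changes
  \<open>y\<close> by order \<open>\<epsilon>\<close> and hence the exponent by order 1, so the
  value after one tremble is free of \<open>\<epsilon>\<close>. The submartingale property is
  \<open>exp_two_point_le_1\<close> with the two utilities as \<open>U\<close> and
  \<open>v\<close>.\<close>

lemma improving_edge_subharmonic:
  assumes \<alpha>: "\<alpha> \<in> profiles A" and a: "a \<in> A i" "a \<noteq> \<alpha> i"
    and \<rho>: "0 < \<rho>" "\<rho> * u i \<alpha> \<le> 1" "\<rho> * ((u i (\<alpha>(i := a)))\<^sup>2 + (u i \<alpha>)\<^sup>2) \<le> u i (\<alpha>(i := a)) - u i \<alpha>"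
  obtains H where "subharmonic H"
    "H (update u \<epsilon> (\<alpha>(i := a)) (pure \<alpha>)) = 1 - exp (- (\<rho> * u i (\<alpha>(i := a))))"
    "H (pure (\<alpha>(i := a))) \<le> 1" "\<And>\<alpha>'. \<alpha>' \<noteq> \<alpha>(i := a) \<Longrightarrow> H (pure \<alpha>') = 0"
proof -
  have \<epsilon>: "0 < \<epsilon>" using step by (simp add: admissible_step_def)
  let ?\<beta> = "\<alpha>(i := a)"
  have \<beta>: "?\<beta> \<in> profiles A" using \<alpha> a by (auto simp: profiles_def)
  have pos: "0 < u i \<alpha>" "0 < u i ?\<beta>"
    using rate[OF \<alpha>, of i] rate[OF \<beta>, of i] \<epsilon> by (auto simp: zero_less_mult_iff)
  define \<gamma> where "\<gamma> y = 1 - exp (- (\<rho> / \<epsilon> * y))" for y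
  have sub: "\<gamma> y \<le> y * \<gamma> (y + \<epsilon> * u i ?\<beta> * (1 - y)) + (1 - y) * \<gamma> (y - \<epsilon> * u i \<alpha> * y)"
    if y: "0 \<le> y" "y \<le> 1" for y
  proof -
    let ?e = "exp (- (\<rho> / \<epsilon> * y))"
    have 1: "exp (- (\<rho> / \<epsilon> * (y + \<epsilon> * u i ?\<beta> * (1 - y)))) = ?e * exp (- (\<rho> * u i ?\<beta> * (1 - y)))"
      using \<epsilon> by (simp add: field_simps flip: exp_add)
    have 2: "exp (- (\<rho> / \<epsilon> * (y - \<epsilon> * u i \<alpha> * y))) = ?e * exp (\<rho> * u i \<alpha> * y)"
      using \<epsilon> by (simp add: field_simps flip: exp_add)
    have "?e * (y * exp (- (\<rho> * u i ?\<beta> * (1 - y))) + (1 - y) * exp (\<rho> * u i \<alpha> * y)) \<le> ?e * 1"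
      using y \<rho> pos by (intro mult_left_mono exp_two_point_le_1) auto
    then show ?thesis unfolding \<gamma>_def 1 2 by (simp add: algebra_simps)
  qed
  show ?thesis
  proof (rule edge_subharmonic[OF \<alpha> a, of \<gamma>])
    show "continuous_on UNIV \<gamma>" unfolding \<gamma>_def by (intro continuous_intros)
    show "0 \<le> \<gamma> y \<and> \<gamma> y \<le> 1" if "0 \<le> y" for y using that \<rho> \<epsilon> by (simp add: \<gamma>_def)
    show "\<gamma> y \<le> \<gamma> z" if "y \<le> z" for y z
      using that \<rho> \<epsilon> by (simp add: \<gamma>_def divide_right_mono)
    show "\<gamma> 0 = 0" by (simp add: \<gamma>_def)
    fix H assume "subharmonic H" "H (update u \<epsilon> ?\<beta> (pure \<alpha>)) = \<gamma> (\<epsilon> * u i ?\<beta>)"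
      "H (pure ?\<beta>) = \<gamma> 1" "\<And>\<alpha>'. \<alpha>' \<noteq> ?\<beta> \<Longrightarrow> H (pure \<alpha>') = 0"
    then show thesis using \<epsilon> by (intro that[of H]) (auto simp: \<gamma>_def)
  qed (use sub in auto)
qed

text \<open>On the edge the identity has drift \<open>\<epsilon> * y * (1 - y)\<close> times the
  utility difference, which is nonnegative.\<close>

lemma weakly_improving_edge_subharmonic:
  assumes \<alpha>: "\<alpha> \<in> profiles A" and a: "a \<in> A i" "a \<noteq> \<alpha> i" and le: "u i \<alpha> \<le> u i (\<alpha>(i := a))"
  obtains H where "subharmonic H" "H (update u \<epsilon> \<alpha> (pure (\<alpha>(i := a)))) = 1 - \<epsilon> * u i \<alpha>"
    "H (pure (\<alpha>(i := a))) = 1" "\<And>\<alpha>'. \<alpha>' \<noteq> \<alpha>(i := a) \<Longrightarrow> H (pure \<alpha>') = 0"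
proof -
  have \<epsilon>: "0 < \<epsilon>" using step by (simp add: admissible_step_def)
  have sub: "y \<le> y * (y + \<epsilon> * u i (\<alpha>(i := a)) * (1 - y)) + (1 - y) * (y - \<epsilon> * u i \<alpha> * y)"
    if y: "0 \<le> y" "y \<le> 1" for y
  proof -
    have "0 \<le> \<epsilon> * (y * (1 - y)) * (u i (\<alpha>(i := a)) - u i \<alpha>)"
      using y \<epsilon> le by (intro mult_nonneg_nonneg) auto
    then show ?thesis by (simp add: algebra_simps)
  qed
  show ?thesis
    by (rule edge_subharmonic[OF \<alpha> a, of "\<lambda>y. y"])
      (use sub in \<open>auto intro: that\<close>)
qed

section \<open>Bounds on the limit weights\<close>

text \<open>In \<open>limit_weights_single_tremble\<close> for the function of this edge, the left
  side is reduced to the tremble from \<open>\<alpha>\<close> to \<open>\<alpha>(i := a)\<close>,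
  while on the right \<open>\<alpha>(i := a)\<close> is the only pure state where the function can
  be nonzero.\<close>

lemma weight_bound_improving_edge:
  assumes w: "limit_weights A u \<epsilon> w"
    and \<alpha>: "\<alpha> \<in> profiles A" and a: "a \<in> A i" "a \<noteq> \<alpha> i"
    and \<rho>: "0 < \<rho>" "\<rho> * u i \<alpha> \<le> 1" "\<rho> * ((u i (\<alpha>(i := a)))\<^sup>2 + (u i \<alpha>)\<^sup>2) \<le> u i (\<alpha>(i := a)) - u i \<alpha>"
  shows "w \<alpha> * ((1 - exp (- (\<rho> * u i (\<alpha>(i := a))))) / real (card (A i))) \<le> real CARD('i) * w (\<alpha>(i := a))"
proof -
  let ?\<beta> = "\<alpha>(i := a)"
  have \<beta>: "?\<beta> \<in> profiles A" using \<alpha> a by (auto simp: profiles_def)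
  have w0: "\<And>\<alpha>. \<alpha> \<in> profiles A \<Longrightarrow> 0 \<le> w \<alpha>" using w by (simp add: limit_weights_def)
  obtain H where H: "subharmonic H"
    "H (update u \<epsilon> ?\<beta> (pure \<alpha>)) = 1 - exp (- (\<rho> * u i ?\<beta>))"
    "H (pure ?\<beta>) \<le> 1" "\<And>\<alpha>'. \<alpha>' \<noteq> ?\<beta> \<Longrightarrow> H (pure \<alpha>') = 0"
    using improving_edge_subharmonic[OF \<alpha> a \<rho>] by blast
  let ?S = "\<lambda>\<alpha>. \<Sum>i\<in>UNIV. (\<Sum>a\<in>A i. H (update u \<epsilon> (\<alpha>(i := a)) (pure \<alpha>))) / real (card (A i))"
  have H0: "0 \<le> H (update u \<epsilon> (\<alpha>'(j := b)) (pure \<alpha>'))" if "\<alpha>' \<in> profiles A" "b \<in> A j" for \<alpha>' j b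
    using H(1) update_mixed[OF pure_mixed[OF that(1)], of "\<alpha>'(j := b)"] that
    by (auto simp: subharmonic_def profiles_def)
  have S0: "0 \<le> ?S \<alpha>'" if "\<alpha>' \<in> profiles A" for \<alpha>'
    using H0[OF that] by (intro sum_nonneg divide_nonneg_nonneg) auto
  have "(1 - exp (- (\<rho> * u i ?\<beta>))) / real (card (A i)) \<le> (\<Sum>a\<in>A i. H (update u \<epsilon> (\<alpha>(i := a)) (pure \<alpha>))) / real (card (A i))"
    unfolding H(2)[symmetric] using a H0[OF \<alpha>]
    by (intro divide_right_mono member_le_sum[of a "A i" "\<lambda>a. H (update u \<epsilon> (\<alpha>(i := a)) (pure \<alpha>))"]) auto
  also have "\<dots> \<le> ?S \<alpha>"
    using H0[OF \<alpha>]
    by (intro member_le_sum[of i UNIV "\<lambda>i. (\<Sum>a\<in>A i. H (update u \<epsilon> (\<alpha>(i := a)) (pure \<alpha>))) / real (card (A i))"]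
        divide_nonneg_nonneg sum_nonneg) auto
  finally have "w \<alpha> * ((1 - exp (- (\<rho> * u i ?\<beta>))) / real (card (A i))) \<le> w \<alpha> * ?S \<alpha>"
    using w0[OF \<alpha>] by (rule mult_left_mono)
  also have "\<dots> \<le> (\<Sum>\<alpha>\<in>profiles A. w \<alpha> * ?S \<alpha>)"
    using \<alpha> w0 S0 by (intro member_le_sum[of \<alpha> "profiles A" "\<lambda>\<alpha>. w \<alpha> * ?S \<alpha>"]) auto
  also have "\<dots> \<le> real CARD('i) * (\<Sum>\<alpha>\<in>profiles A. w \<alpha> * H (pure \<alpha>))"
    by (rule limit_weights_single_tremble[OF w H(1)])
  also have "(\<Sum>\<alpha>\<in>profiles A. w \<alpha> * H (pure \<alpha>)) = (\<Sum>\<alpha>\<in>{?\<beta>}. w \<alpha> * H (pure \<alpha>))"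
    using \<beta> H(4) by (intro sum.mono_neutral_right) auto
  also have "real CARD('i) * \<dots> \<le> real CARD('i) * w ?\<beta>"
    using H(3) w0[OF \<beta>] by (intro mult_left_mono) (auto simp: mult_left_le)
  finally show ?thesis .
qed

text \<open>Around a Nash equilibrium the maximum of the submartingales of all incident edges loses only
  order \<open>\<epsilon>\<close> after a single tremble, so hardly any weight can flow in from \<open>\<alpha>\<close>.\<close>

lemma weight_bound_edge_to_equilibrium:
  assumes w: "limit_weights A u \<epsilon> w"
    and \<alpha>: "\<alpha> \<in> profiles A" and a: "a \<in> A i" "a \<noteq> \<alpha> i" and NE: "pure_NE A u (\<alpha>(i := a))"
    and \<rho>: "0 < \<rho>" "\<rho> * u i \<alpha> \<le> 1" "\<rho> * ((u i (\<alpha>(i := a)))\<^sup>2 + (u i \<alpha>)\<^sup>2) \<le> u i (\<alpha>(i := a)) - u i \<alpha>"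
    and B: "\<And>j \<alpha>'. \<alpha>' \<in> profiles A \<Longrightarrow> u j \<alpha>' \<le> B"
  shows "w \<alpha> * ((1 - exp (- (\<rho> * u i (\<alpha>(i := a))))) / real (card (A i))) \<le> real CARD('i) * (\<epsilon> * B)"
proof -
  have \<epsilon>: "0 < \<epsilon>" using step by (simp add: admissible_step_def)
  define \<beta> where "\<beta> = \<alpha>(i := a)"
  have \<beta>: "\<beta> \<in> profiles A" using \<alpha> a by (auto simp: \<beta>_def profiles_def)
  have \<alpha>\<beta>: "\<alpha> \<noteq> \<beta>" using a by (auto simp: \<beta>_def fun_eq_iff)
  have w0: "\<And>\<alpha>. \<alpha> \<in> profiles A \<Longrightarrow> 0 \<le> w \<alpha>" using w by (simp add: limit_weights_def)
  have w1: "w \<beta> \<le> 1"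
    using member_le_sum[OF \<beta>, of w] w by (simp add: limit_weights_def)
  have "0 < u i \<beta>" using rate[OF \<beta>, of i] \<epsilon> zero_less_mult_pos by blast
  then have B0: "0 \<le> B" using B[OF \<beta>, of i] by linarith
  define v where "v \<alpha>' = (if \<alpha>' = \<beta> then 1 else 0 :: real)" for \<alpha>'
  obtain H where H: "subharmonic H" "H (update u \<epsilon> \<beta> (pure \<alpha>)) = 1 - exp (- (\<rho> * u i \<beta>))"
    "H (pure \<beta>) \<le> 1" "\<And>\<alpha>'. \<alpha>' \<noteq> \<beta> \<Longrightarrow> H (pure \<alpha>') = 0"
    using improving_edge_subharmonic[OF \<alpha> a \<rho>] unfolding \<beta>_def by blast
  \<comment> \<open>The unilateral deviations from the equilibrium. Read backwards, each is an edge
    towards \<open>\<beta>\<close> along which the utility of the deviator does not fall.\<close>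
  define E where "E = {(j, b). b \<in> A j \<and> b \<noteq> \<beta> j}"
  have "\<exists>H. subharmonic H \<and> H (update u \<epsilon> (\<beta>(j := b)) (pure \<beta>)) \<ge> 1 - \<epsilon> * B \<and>
      H (pure \<beta>) = 1 \<and> (\<forall>\<alpha>'. \<alpha>' \<noteq> \<beta> \<longrightarrow> H (pure \<alpha>') = 0)" if jb: "(j, b) \<in> E" for j b
  proof -
    let ?\<alpha> = "\<beta>(j := b)"
    have b: "b \<in> A j" "b \<noteq> \<beta> j" using jb by (auto simp: E_def)
    have e: "?\<alpha>(j := \<beta> j) = \<beta>" by simp
    have P: "?\<alpha> \<in> profiles A" using \<beta> b by (auto simp: profiles_def)
    have "u j ?\<alpha> \<le> u j (?\<alpha>(j := \<beta> j))"
      using NE b unfolding \<beta>_def[symmetric] e by (auto simp: pure_NE_def BR_def)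
    moreover have "\<beta> j \<in> A j" "\<beta> j \<noteq> ?\<alpha> j" using \<beta> b by (auto simp: profiles_def)
    ultimately obtain H where "subharmonic H" "H (update u \<epsilon> ?\<alpha> (pure (?\<alpha>(j := \<beta> j)))) = 1 - \<epsilon> * u j ?\<alpha>"
      "H (pure (?\<alpha>(j := \<beta> j))) = 1" "\<And>\<alpha>'. \<alpha>' \<noteq> ?\<alpha>(j := \<beta> j) \<Longrightarrow> H (pure \<alpha>') = 0"
      using weakly_improving_edge_subharmonic[OF P] by blast
    moreover have "\<epsilon> * u j ?\<alpha> \<le> \<epsilon> * B" using B[OF P] \<epsilon> by (intro mult_left_mono) auto
    ultimately show ?thesis unfolding e by (intro exI[of _ H]) auto
  qed
  then obtain L where L: "\<And>j b. (j, b) \<in> E \<Longrightarrow> subharmonic (L j b) \<and> L j b (update u \<epsilon> (\<beta>(j := b)) (pure \<beta>)) \<ge> 1 - \<epsilon> * B \<and>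
      L j b (pure \<beta>) = 1 \<and> (\<forall>\<alpha>'. \<alpha>' \<noteq> \<beta> \<longrightarrow> L j b (pure \<alpha>') = 0)"
    by metis
  define K where "K = insert H ((\<lambda>(j, b). L j b) ` E)"
  have "finite K" unfolding K_def by simp
  moreover have "subharmonic G" if "G \<in> K" for G using that H L by (auto simp: K_def)
  moreover have "G (pure \<alpha>') \<le> v \<alpha>'" if "G \<in> K" for G \<alpha>'
  proof (cases "G = H")
    case True then show ?thesis using H by (simp add: v_def)
  next
    case False
    then obtain j b where "(j, b) \<in> E" "G = L j b" using \<open>G \<in> K\<close> by (auto simp: K_def)
    then show ?thesis using L[of j b] by (simp add: v_def)
  qed
  moreover have "0 \<le> v \<alpha>'" for \<alpha>' by (simp add: v_def)
  ultimately obtain F where F: "subharmonic F" "\<And>G x. G \<in> K \<Longrightarrow> G x \<le> F x"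
    "\<And>\<alpha>'. \<alpha>' \<in> profiles A \<Longrightarrow> F (pure \<alpha>') \<le> v \<alpha>'"
    using subharmonic_finite_upper_bound[of K v] by blast
  let ?S = "\<lambda>\<alpha>. \<Sum>i\<in>UNIV. (\<Sum>a\<in>A i. F (update u \<epsilon> (\<alpha>(i := a)) (pure \<alpha>))) / real (card (A i))"
  have F0: "0 \<le> F (update u \<epsilon> (\<alpha>'(j := b)) (pure \<alpha>'))" if "\<alpha>' \<in> profiles A" "b \<in> A j" for \<alpha>' j b
    using F(1) update_mixed[OF pure_mixed[OF that(1)], of "\<alpha>'(j := b)"] that
    by (auto simp: subharmonic_def profiles_def)
  have S0: "0 \<le> ?S \<alpha>'" if "\<alpha>' \<in> profiles A" for \<alpha>'
    using F0[OF that] by (intro sum_nonneg divide_nonneg_nonneg) auto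
  have "1 - exp (- (\<rho> * u i \<beta>)) \<le> F (update u \<epsilon> \<beta> (pure \<alpha>))"
    using F(2)[of H "update u \<epsilon> \<beta> (pure \<alpha>)"] H(2) by (simp add: K_def)
  also have "\<dots> \<le> (\<Sum>a\<in>A i. F (update u \<epsilon> (\<alpha>(i := a)) (pure \<alpha>)))"
    unfolding \<beta>_def using a F0[OF \<alpha>]
    by (intro member_le_sum[of a "A i" "\<lambda>a. F (update u \<epsilon> (\<alpha>(i := a)) (pure \<alpha>))"]) auto
  finally have "(1 - exp (- (\<rho> * u i \<beta>))) / real (card (A i)) \<le> (\<Sum>a\<in>A i. F (update u \<epsilon> (\<alpha>(i := a)) (pure \<alpha>))) / real (card (A i))"
    by (intro divide_right_mono) auto
  also have "\<dots> \<le> ?S \<alpha>"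
    using F0[OF \<alpha>]
    by (intro member_le_sum[of i UNIV "\<lambda>i. (\<Sum>a\<in>A i. F (update u \<epsilon> (\<alpha>(i := a)) (pure \<alpha>))) / real (card (A i))"]
        divide_nonneg_nonneg sum_nonneg) auto
  finally have S\<alpha>: "w \<alpha> * ((1 - exp (- (\<rho> * u i \<beta>))) / real (card (A i))) \<le> w \<alpha> * ?S \<alpha>"
    using w0[OF \<alpha>] by (rule mult_left_mono)
  \<comment> \<open>Every tremble at \<open>\<beta>\<close> costs at most
    \<open>\<epsilon> * B\<close>. The trivial one leaves the state unchanged, and the deviation to
    \<open>\<alpha> i\<close> supplies a function with value 1 there.\<close>
  have F\<beta>: "1 - \<epsilon> * B \<le> F (update u \<epsilon> (\<beta>(j := b)) (pure \<beta>))" if "b \<in> A j" for j b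
  proof (cases "b = \<beta> j")
    case True
    have "(i, \<alpha> i) \<in> E" using \<alpha> a by (auto simp: E_def \<beta>_def profiles_def)
    then have "1 \<le> F (pure \<beta>)" using L[of i "\<alpha> i"] F(2)[of "L i (\<alpha> i)" "pure \<beta>"] by (force simp: K_def)
    moreover have "update u \<epsilon> \<beta> (pure \<beta>) = pure \<beta>" by (simp add: update_def)
    moreover have "0 \<le> \<epsilon> * B" using \<epsilon> B0 by simp
    ultimately show ?thesis using True by simp
  next
    case False
    then have "(j, b) \<in> E" using that by (simp add: E_def)
    then show ?thesis using L[of j b] F(2)[of "L j b" "update u \<epsilon> (\<beta>(j := b)) (pure \<beta>)"] by (force simp: K_def)
  qed
  have "real CARD('i) * (1 - \<epsilon> * B) = (\<Sum>j\<in>(UNIV :: 'i set). (\<Sum>b\<in>A j. 1 - \<epsilon> * B) / real (card (A j)))"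
    using nonempty by simp
  also have "\<dots> \<le> ?S \<beta>" using F\<beta> by (intro sum_mono divide_right_mono) auto
  finally have S\<beta>: "w \<beta> * (real CARD('i) * (1 - \<epsilon> * B)) \<le> w \<beta> * ?S \<beta>"
    using w0[OF \<beta>] by (rule mult_left_mono)
  have "w \<alpha> * ?S \<alpha> + w \<beta> * ?S \<beta> = (\<Sum>\<alpha>'\<in>{\<alpha>, \<beta>}. w \<alpha>' * ?S \<alpha>')" using \<alpha>\<beta> by simp
  also have "\<dots> \<le> (\<Sum>\<alpha>\<in>profiles A. w \<alpha> * ?S \<alpha>)"
    using \<alpha> \<beta> w0 S0 by (intro sum_mono2) auto
  also have "\<dots> \<le> real CARD('i) * (\<Sum>\<alpha>\<in>profiles A. w \<alpha> * F (pure \<alpha>))"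
    by (rule limit_weights_single_tremble[OF w F(1)])
  also have "\<dots> \<le> real CARD('i) * (\<Sum>\<alpha>\<in>profiles A. w \<alpha> * v \<alpha>)"
    using F(3) w0 by (intro mult_left_mono sum_mono) auto
  also have "(\<Sum>\<alpha>\<in>profiles A. w \<alpha> * v \<alpha>) = w \<beta>" using \<beta> by (simp add: v_def if_distrib cong: if_cong)
  finally have "w \<alpha> * ?S \<alpha> + w \<beta> * ?S \<beta> \<le> real CARD('i) * w \<beta>" .
  \<comment> \<open>The main part \<open>n * w \<beta>\<close>, with \<open>n\<close> the number of
    players, occurs on both sides and cancels; only the loss of order \<open>\<epsilon>\<close>
    remains to bound the inflow from \<open>\<alpha>\<close>.\<close>
  with S\<alpha> S\<beta> have "w \<alpha> * ((1 - exp (- (\<rho> * u i \<beta>))) / real (card (A i))) \<le> w \<beta> * (real CARD('i) * (\<epsilon> * B))"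
    by (simp add: algebra_simps)
  also have "\<dots> \<le> 1 * (real CARD('i) * (\<epsilon> * B))"
    using w1 \<epsilon> B0 by (intro mult_right_mono) auto
  finally show ?thesis by (simp add: \<beta>_def)
qed

end

section \<open>Best reply paths in coordination games, and small step sizes\<close>

text \<open>Let a player who is not best replying switch to a maximiser: this player gains strictly,
  and in a coordination game nobody loses. Total utility therefore rises strictly.\<close>

lemma coordination_improvement:
  fixes A :: "'i::finite \<Rightarrow> 'a::finite set"
  assumes nonempty: "\<And>i. A i \<noteq> {}" and coord: "coordination_game A u"
    and \<alpha>: "\<alpha> \<in> profiles A" "\<not> pure_NE A u \<alpha>"
  obtains i a where "a \<in> A i" "u i \<alpha> < u i (\<alpha>(i := a))" "\<And>j. u j \<alpha> \<le> u j (\<alpha>(i := a))"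
proof -
  obtain i where i: "\<alpha> i \<notin> BR A u i \<alpha>" using \<alpha> by (auto simp: pure_NE_def)
  let ?V = "(\<lambda>b. u i (\<alpha>(i := b))) ` A i"
  have "Max ?V \<in> ?V" using nonempty[of i] by (intro Max_in) auto
  then obtain a where a: "a \<in> A i" "Max ?V = u i (\<alpha>(i := a))" by auto
  have a_max: "u i (\<alpha>(i := b)) \<le> u i (\<alpha>(i := a))" if "b \<in> A i" for b
    unfolding a(2)[symmetric] using that by (intro Max_ge) auto
  obtain b where b: "b \<in> A i" "u i \<alpha> < u i (\<alpha>(i := b))"
    using i \<alpha> by (auto simp: BR_def profiles_def not_le)
  have "a \<in> BR A u i \<alpha>" using a(1) a_max by (simp add: BR_def)
  then have "u j \<alpha> \<le> u j (\<alpha>(i := a))" for j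
    using coord \<alpha> by (auto simp: coordination_game_def)
  moreover have "u i \<alpha> < u i (\<alpha>(i := a))" using b(2) a_max[OF b(1)] by linarith
  ultimately show ?thesis using that a(1) by blast
qed

lemma eventually_admissible_step:
  fixes A :: "'i::finite \<Rightarrow> 'a::finite set"
  assumes "coordination_game A u"
  shows "\<forall>\<^sub>F \<epsilon> in at_right 0. admissible_step A u \<epsilon>"
proof -
  have "\<forall>\<^sub>F \<epsilon> in at_right 0. \<epsilon> * u i \<alpha> < 1" for i \<alpha>
  proof -
    have "((\<lambda>\<epsilon>. \<epsilon> * u i \<alpha>) \<longlongrightarrow> 0 * u i \<alpha>) (at_right 0)" by (intro tendsto_intros)
    then show ?thesis by (rule order_tendstoD) simp
  qed
  then have "\<forall>\<^sub>F \<epsilon> in at_right 0. \<forall>(i, \<alpha>)\<in>UNIV. \<epsilon> * u i \<alpha> < 1"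
    by (intro eventually_ball_finite) auto
  moreover have "\<forall>\<^sub>F \<epsilon> in at_right 0. (0 :: real) < \<epsilon>" by (simp add: eventually_at_right_less)
  ultimately show ?thesis
    by eventually_elim (use assms in \<open>auto simp: admissible_step_def coordination_game_def\<close>)
qed

text \<open>Induction along best replies, on the number of profiles with larger total utility. A
  reply that is an equilibrium bounds the weight by order \<open>\<epsilon>\<close>; otherwise the
  weight is at most a constant times that of the reply, which vanishes by induction.\<close>

lemma non_equilibrium_weight_vanishes:
  fixes A :: "'i::finite \<Rightarrow> 'a::finite set"
  assumes nonempty: "\<And>i. A i \<noteq> {}" and coord: "coordination_game A u"
    and pi: "\<And>\<epsilon>. admissible_step A u \<epsilon> \<Longrightarrow> limit_weights A u \<epsilon> (\<pi> \<epsilon>)"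
    and "\<alpha> \<in> profiles A" "\<not> pure_NE A u \<alpha>"
  shows "((\<lambda>\<epsilon>. \<pi> \<epsilon> \<alpha>) \<longlongrightarrow> 0) (at_right 0)"
  using assms(4,5)
proof (induction "card {\<alpha>'. (\<Sum>j\<in>UNIV. u j \<alpha>) < (\<Sum>j\<in>UNIV. u j \<alpha>')}" arbitrary: \<alpha> rule: less_induct)
  case less
  obtain i a where a: "a \<in> A i" "u i \<alpha> < u i (\<alpha>(i := a))" "\<And>j. u j \<alpha> \<le> u j (\<alpha>(i := a))"
    using coordination_improvement[OF nonempty coord less.prems] by blast
  define \<beta> where "\<beta> = \<alpha>(i := a)"
  have a_ne: "a \<noteq> \<alpha> i" using a(2) by auto
  have \<beta>: "\<beta> \<in> profiles A" using less.prems a by (auto simp: \<beta>_def profiles_def)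
  have pos: "0 < u j \<alpha>'" if "\<alpha>' \<in> profiles A" for j \<alpha>'
    using coord that by (auto simp: coordination_game_def)
  have lt: "u i \<alpha> < u i \<beta>" using a by (simp add: \<beta>_def)
  define D where "D = (u i \<beta>)\<^sup>2 + (u i \<alpha>)\<^sup>2"
  have D: "0 < D" using pos[OF \<beta>, of i] by (auto simp: D_def intro: add_pos_nonneg)
  \<comment> \<open>The largest value meeting both conditions on the exponent. It depends on the
    utilities alone, so \<open>\<kappa>\<close> below is a positive constant as
    \<open>\<epsilon>\<close> tends to 0.\<close>
  define \<rho> where "\<rho> = min (1 / u i \<alpha>) ((u i \<beta> - u i \<alpha>) / D)"
  have \<rho>: "0 < \<rho>" "\<rho> * u i \<alpha> \<le> 1" "\<rho> * D \<le> u i \<beta> - u i \<alpha>"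
    using pos[OF less.prems(1), of i] lt D
    by (auto simp: \<rho>_def min_less_iff_conj simp flip: pos_le_divide_eq)
  define \<kappa> where "\<kappa> = (1 - exp (- (\<rho> * u i \<beta>))) / real (card (A i))"
  have \<kappa>: "0 < \<kappa>" using \<rho>(1) pos[OF \<beta>, of i] nonempty[of i] by (simp add: \<kappa>_def card_gt_0_iff)
  have w0: "0 \<le> \<pi> \<epsilon> \<alpha>" if "admissible_step A u \<epsilon>" for \<epsilon>
    using pi[OF that] less.prems by (simp add: limit_weights_def)
  have "\<exists>g. (g \<longlongrightarrow> 0) (at_right 0) \<and> (\<forall>\<epsilon>. admissible_step A u \<epsilon> \<longrightarrow> \<pi> \<epsilon> \<alpha> * \<kappa> \<le> g \<epsilon>)"
  proof (cases "pure_NE A u \<beta>")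
    case True
    \<comment> \<open>The maximum is over the whole finite function type, so \<open>B\<close> bounds
      all utilities and is free of \<open>\<epsilon>\<close>.\<close>
    define B where "B = Max (range (\<lambda>(j, \<alpha>'). u j \<alpha>'))"
    have B: "u j \<alpha>' \<le> B" for j \<alpha>'
      unfolding B_def by (intro Max_ge) (auto intro: rev_image_eqI[of "(j, \<alpha>')"])
    have "((\<lambda>\<epsilon>. real CARD('i) * (\<epsilon> * B)) \<longlongrightarrow> real CARD('i) * (0 * B)) (at_right 0)"
      by (intro tendsto_intros)
    moreover have "\<pi> \<epsilon> \<alpha> * \<kappa> \<le> real CARD('i) * (\<epsilon> * B)" if adm: "admissible_step A u \<epsilon>" for \<epsilon>
    proof -
      interpret learning_automata A u \<epsilon> using nonempty adm by unfold_locales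
      show ?thesis
        using weight_bound_edge_to_equilibrium[OF pi[OF adm] less.prems(1) a(1) a_ne _ \<rho>(1,2) _ B] True \<rho>(3)
        by (simp add: \<kappa>_def \<beta>_def D_def)
    qed
    ultimately show ?thesis by (intro exI[of _ "\<lambda>\<epsilon>. real CARD('i) * (\<epsilon> * B)"]) auto
  next
    case False
    have "(\<Sum>j\<in>UNIV. u j \<alpha>) < (\<Sum>j\<in>UNIV. u j \<beta>)"
      using a by (intro sum_strict_mono_ex1) (auto simp: \<beta>_def)
    then have "card {\<alpha>'. (\<Sum>j\<in>UNIV. u j \<beta>) < (\<Sum>j\<in>UNIV. u j \<alpha>')} < card {\<alpha>'. (\<Sum>j\<in>UNIV. u j \<alpha>) < (\<Sum>j\<in>UNIV. u j \<alpha>')}"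
      by (intro psubset_card_mono) auto
    from less.hyps[OF this \<beta> False]
    have "((\<lambda>\<epsilon>. real CARD('i) * \<pi> \<epsilon> \<beta>) \<longlongrightarrow> real CARD('i) * 0) (at_right 0)"
      by (intro tendsto_intros)
    moreover have "\<pi> \<epsilon> \<alpha> * \<kappa> \<le> real CARD('i) * \<pi> \<epsilon> \<beta>" if adm: "admissible_step A u \<epsilon>" for \<epsilon>
    proof -
      interpret learning_automata A u \<epsilon> using nonempty adm by unfold_locales
      show ?thesis
        using weight_bound_improving_edge[OF pi[OF adm] less.prems(1) a(1) a_ne \<rho>(1,2)] \<rho>(3)
        by (simp add: \<kappa>_def \<beta>_def D_def)
    qed
    ultimately show ?thesis by (intro exI[of _ "\<lambda>\<epsilon>. real CARD('i) * \<pi> \<epsilon> \<beta>"]) auto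
  qed
  then obtain g where g: "(g \<longlongrightarrow> 0) (at_right 0)"
    "\<And>\<epsilon>. admissible_step A u \<epsilon> \<Longrightarrow> \<pi> \<epsilon> \<alpha> * \<kappa> \<le> g \<epsilon>" by blast
  show ?case
  proof (rule Lim_null_comparison)
    show "\<forall>\<^sub>F \<epsilon> in at_right 0. norm (\<pi> \<epsilon> \<alpha>) \<le> g \<epsilon> / \<kappa>"
      using eventually_admissible_step[OF coord]
    proof eventually_elim
      case (elim \<epsilon>)
      then show ?case using w0[OF elim] g(2)[OF elim] \<kappa> by (simp add: pos_le_divide_eq)
    qed
    show "((\<lambda>\<epsilon>. g \<epsilon> / \<kappa>) \<longlongrightarrow> 0) (at_right 0)" using tendsto_divide[OF g(1) tendsto_const, of \<kappa>] \<kappa> by simp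
  qed
qed

theorem theorem6p1:
  fixes A :: "'i::finite \<Rightarrow> 'a::finite set"
    and u :: "'i \<Rightarrow> ('i \<Rightarrow> 'a) \<Rightarrow> real"
    and \<pi> :: "real \<Rightarrow> ('i \<Rightarrow> 'a) \<Rightarrow> real"
  assumes nonempty: "\<And>i. A i \<noteq> {}"
    and coord: "coordination_game A u"
    and pi: "\<And>\<epsilon>. admissible_step A u \<epsilon> \<Longrightarrow> limit_weights A u \<epsilon> (\<pi> \<epsilon>)"
    and alpha: "\<alpha> \<in> profiles A"
    and stable: "stochastically_stable \<pi> \<alpha>"
  shows "pure_NE A u \<alpha>"
  using non_equilibrium_weight_vanishes[OF nonempty coord pi alpha] stable
  unfolding stochastically_stable_def by blast

end
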